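(* Let $(\mathscr A_1,\dots,\mathscr A_m)$, $m\ge2$, be a factorizing sequence for a finitary abelian category $\mathscr A$. Then: (a) $\mathrm{Exp}_{\mathscr A}=\mathrm{Exp}_{\mathscr A_1}\cdots\mathrm{Exp}_{\mathscr A_m}$. (b) If, additionally, $\mathrm{Ext}^1_{\mathscr A}(A_i,A_j)=0$ for all $i<j$ and all objects $A_i$ of $\mathscr A_i$ and $A_j$ of $\mathscr A_j$, then $H_{\mathscr A}\cong H_{\mathscr A_1}\otimes\cdots\otimes H_{\mathscr A_m}$ as a vector space.
   Context: An (essentially small) abelian category $\mathscr A$ is finitary if all $\mathrm{Hom}_{\mathscr A}(M,N)$ and $\mathrm{Ext}^1_{\mathscr A}(M,N)$ are finite sets. The Hall algebra $H_{\mathscr A}$ is the $\mathbb Q$-vector space with basis the set $\mathrm{Iso}\,\mathscr A$ of isomorphism classes and multiplication $[M][N]=\sum_{[K]}F_{MN}^K[K]$, where $F_{MN}^K$ is the number of subobjects $U\subset K$ with $U\cong N$, $K/U\cong M$. For a full subcategory $\mathscr B$ closed under extensions, $H_{\mathscr B}\subset H_{\mathscr A}$ is the subalgebra spanned by the classes of objects of $\mathscr B$, and $\mathrm{Exp}_{\mathscr B}=\sum_{[B]\in\mathrm{Iso}\,\mathscr B}[B]$, an element of the completion of the Hall algebra with respect to its $K_0(\mathscr A)$-grading. Factorizing pair: an ordered pair $(\mathscr A',\mathscr A'')$ of full subcategories closed under extensions is a factorizing pair for $\mathscr A$ if every object $M$ of $\mathscr A$ has a unique subobject $M''$ that is an object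 of $\mathscr A''$ and such that $M/M''$ is an object of $\mathscr A'$ (the same definition is used when $\mathscr A$ is replaced by a full subcategory closed under extensions). A factorizing sequence $(\mathscr A_1,\dots,\mathscr A_m)$, $m\ge2$, for $\mathscr A$ is defined recursively: if $m\ge3$, then $(\mathscr A_1,\dots,\mathscr A_{m-1})$ is a factorizing sequence for $\mathscr A_{\le m-1}$, the minimal additive subcategory of $\mathscr A$ containing $\mathscr A_1,\dots,\mathscr A_{m-1}$ and closed under extensions; and $(\mathscr A_{\le m-1},\mathscr A_m)$ is a factorizing pair for $\mathscr A$ (with $\mathscr A_{\le1}=\mathscr A_1$). *)

theory Defs
  imports Complex_Main "HOL-Algebra.AbelCoset" "HOL-Algebra.Module"
begin

section \<open>Finitary abelian categories\<close>

record ('o, 'm) preadd_cat =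
  Ob :: "'o set"
  Ar :: "'m set"
  src :: "'m \<Rightarrow> 'o"
  tgt :: "'m \<Rightarrow> 'o"
  ident :: "'o \<Rightarrow> 'm"
  comp_ar :: "'m \<Rightarrow> 'm \<Rightarrow> 'm"  (infixl \<open>\<cdot>\<index>\<close> 70)
  add_ar :: "'m \<Rightarrow> 'm \<Rightarrow> 'm"
  zero_ar :: "'o \<Rightarrow> 'o \<Rightarrow> 'm"

definition Hom :: "('o, 'm) preadd_cat \<Rightarrow> 'o \<Rightarrow> 'o \<Rightarrow> 'm set" where
  "Hom C X Y = {f \<in> Ar C. src C f = X \<and> tgt C f = Y}"

text \<open>Composition is written in the order of functions: \<open>g \<cdot> f\<close> means first \<open>f\<close>, then \<open>g\<close>.\<close>

locale preadditive_category =
  fixes C :: "('o, 'm) preadd_cat" (structure)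
  assumes src_closed: "f \<in> Ar C \<Longrightarrow> src C f \<in> Ob C"
    and tgt_closed: "f \<in> Ar C \<Longrightarrow> tgt C f \<in> Ob C"
    and ident_closed: "X \<in> Ob C \<Longrightarrow> ident C X \<in> Hom C X X"
    and comp_closed: "\<lbrakk>f \<in> Hom C X Y; g \<in> Hom C Y Z\<rbrakk> \<Longrightarrow> g \<cdot> f \<in> Hom C X Z"
    and comp_assoc: "\<lbrakk>f \<in> Hom C W X; g \<in> Hom C X Y; h \<in> Hom C Y Z\<rbrakk>
          \<Longrightarrow> (h \<cdot> g) \<cdot> f = h \<cdot> (g \<cdot> f)"
    and ident_left: "f \<in> Hom C X Y \<Longrightarrow> ident C Y \<cdot> f = f"
    and ident_right: "f \<in> Hom C X Y \<Longrightarrow> f \<cdot> ident C X = f"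
    and hom_group: "\<lbrakk>X \<in> Ob C; Y \<in> Ob C\<rbrakk> \<Longrightarrow>
          comm_group \<lparr>carrier = Hom C X Y, monoid.mult = add_ar C, one = zero_ar C X Y\<rparr>"
    and comp_add_left: "\<lbrakk>f \<in> Hom C X Y; g \<in> Hom C Y Z; h \<in> Hom C Y Z\<rbrakk>
          \<Longrightarrow> add_ar C g h \<cdot> f = add_ar C (g \<cdot> f) (h \<cdot> f)"
    and comp_add_right: "\<lbrakk>f \<in> Hom C X Y; g \<in> Hom C X Y; h \<in> Hom C Y Z\<rbrakk>
          \<Longrightarrow> h \<cdot> add_ar C f g = add_ar C (h \<cdot> f) (h \<cdot> g)"

definition is_zero_object :: "('o, 'm) preadd_cat \<Rightarrow> 'o \<Rightarrow> bool" where
  "is_zero_object C Z \<longleftrightarrow> Z \<in> Ob C \<and>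
     (\<forall>X\<in>Ob C. (\<exists>!f. f \<in> Hom C Z X) \<and> (\<exists>!f. f \<in> Hom C X Z))"

definition is_mono :: "('o, 'm) preadd_cat \<Rightarrow> 'm \<Rightarrow> bool" where
  "is_mono C u \<longleftrightarrow> u \<in> Ar C \<and>
     (\<forall>W\<in>Ob C. \<forall>f\<in>Hom C W (src C u). \<forall>g\<in>Hom C W (src C u).
        u \<cdot>\<^bsub>C\<^esub> f = u \<cdot>\<^bsub>C\<^esub> g \<longrightarrow> f = g)"

definition is_epi :: "('o, 'm) preadd_cat \<Rightarrow> 'm \<Rightarrow> bool" where
  "is_epi C q \<longleftrightarrow> q \<in> Ar C \<and>
     (\<forall>W\<in>Ob C. \<forall>f\<in>Hom C (tgt C q) W. \<forall>g\<in>Hom C (tgt C q) W.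
        f \<cdot>\<^bsub>C\<^esub> q = g \<cdot>\<^bsub>C\<^esub> q \<longrightarrow> f = g)"

definition is_iso :: "('o, 'm) preadd_cat \<Rightarrow> 'm \<Rightarrow> bool" where
  "is_iso C f \<longleftrightarrow> f \<in> Ar C \<and>
     (\<exists>g\<in>Hom C (tgt C f) (src C f).
        g \<cdot>\<^bsub>C\<^esub> f = ident C (src C f) \<and> f \<cdot>\<^bsub>C\<^esub> g = ident C (tgt C f))"

definition isomorphic :: "('o, 'm) preadd_cat \<Rightarrow> 'o \<Rightarrow> 'o \<Rightarrow> bool" where
  "isomorphic C X Y \<longleftrightarrow> (\<exists>f\<in>Hom C X Y. is_iso C f)"

definition is_kernel :: "('o, 'm) preadd_cat \<Rightarrow> 'm \<Rightarrow> 'm \<Rightarrow> bool" where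
  "is_kernel C k f \<longleftrightarrow> k \<in> Ar C \<and> f \<in> Ar C \<and> tgt C k = src C f \<and>
     f \<cdot>\<^bsub>C\<^esub> k = zero_ar C (src C k) (tgt C f) \<and>
     (\<forall>W\<in>Ob C. \<forall>h\<in>Hom C W (src C f). f \<cdot>\<^bsub>C\<^esub> h = zero_ar C W (tgt C f) \<longrightarrow>
        (\<exists>!l. l \<in> Hom C W (src C k) \<and> k \<cdot>\<^bsub>C\<^esub> l = h))"

definition is_cokernel :: "('o, 'm) preadd_cat \<Rightarrow> 'm \<Rightarrow> 'm \<Rightarrow> bool" where
  "is_cokernel C q f \<longleftrightarrow> q \<in> Ar C \<and> f \<in> Ar C \<and> src C q = tgt C f \<and>
     q \<cdot>\<^bsub>C\<^esub> f = zero_ar C (src C f) (tgt C q) \<and>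
     (\<forall>W\<in>Ob C. \<forall>h\<in>Hom C (tgt C f) W. h \<cdot>\<^bsub>C\<^esub> f = zero_ar C (src C f) W \<longrightarrow>
        (\<exists>!l. l \<in> Hom C (tgt C q) W \<and> l \<cdot>\<^bsub>C\<^esub> q = h))"

definition is_biproduct :: "('o, 'm) preadd_cat \<Rightarrow> 'o \<Rightarrow> 'o \<Rightarrow> 'o \<Rightarrow> bool" where
  "is_biproduct C X Y P \<longleftrightarrow>
     (\<exists>i\<in>Hom C X P. \<exists>j\<in>Hom C Y P. \<exists>p\<in>Hom C P X. \<exists>q\<in>Hom C P Y.
        p \<cdot>\<^bsub>C\<^esub> i = ident C X \<and> q \<cdot>\<^bsub>C\<^esub> j = ident C Y \<and>
        q \<cdot>\<^bsub>C\<^esub> i = zero_ar C X Y \<and> p \<cdot>\<^bsub>C\<^esub> j = zero_ar C Y X \<and>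
        add_ar C (i \<cdot>\<^bsub>C\<^esub> p) (j \<cdot>\<^bsub>C\<^esub> q) = ident C P)"

locale abelian_category = preadditive_category +
  assumes zero_object: "\<exists>Z. is_zero_object C Z"
    and biproducts: "\<lbrakk>X \<in> Ob C; Y \<in> Ob C\<rbrakk> \<Longrightarrow> \<exists>P. is_biproduct C X Y P"
    and kernels: "f \<in> Ar C \<Longrightarrow> \<exists>k. is_kernel C k f"
    and cokernels: "f \<in> Ar C \<Longrightarrow> \<exists>q. is_cokernel C q f"
    and mono_normal: "is_mono C u \<Longrightarrow> \<exists>f. is_kernel C u f"
    and epi_normal: "is_epi C q \<Longrightarrow> \<exists>f. is_cokernel C q f"

definition short_exact :: "('o, 'm) preadd_cat \<Rightarrow> 'm \<Rightarrow> 'm \<Rightarrow> bool" where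
  "short_exact C i p \<longleftrightarrow> is_kernel C i p \<and> is_cokernel C p i"

text \<open>
  \<open>Ext1 C M N\<close> is the Yoneda extension group: equivalence classes of short exact sequences
  \<open>0 \<rightarrow> N \<rightarrow> E \<rightarrow> M \<rightarrow> 0\<close>. Only the underlying set and the zero element (the class of the
  split extensions) are needed.
\<close>

definition extensions :: "('o, 'm) preadd_cat \<Rightarrow> 'o \<Rightarrow> 'o \<Rightarrow> ('m \<times> 'm) set" where
  "extensions C M N = {(i, p). short_exact C i p \<and> src C i = N \<and> tgt C p = M}"

definition ext_equiv :: "('o, 'm) preadd_cat \<Rightarrow> 'o \<Rightarrow> 'o \<Rightarrow> (('m \<times> 'm) \<times> ('m \<times> 'm)) set" where
  "ext_equiv C M N = {((i, p), (i', p')).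
     (i, p) \<in> extensions C M N \<and> (i', p') \<in> extensions C M N \<and>
     (\<exists>\<phi>\<in>Hom C (tgt C i) (tgt C i').
        is_iso C \<phi> \<and> \<phi> \<cdot>\<^bsub>C\<^esub> i = i' \<and> p' \<cdot>\<^bsub>C\<^esub> \<phi> = p)}"

definition Ext1 :: "('o, 'm) preadd_cat \<Rightarrow> 'o \<Rightarrow> 'o \<Rightarrow> ('m \<times> 'm) set set" where
  "Ext1 C M N = extensions C M N // ext_equiv C M N"

definition Ext1_zero :: "('o, 'm) preadd_cat \<Rightarrow> 'o \<Rightarrow> 'o \<Rightarrow> ('m \<times> 'm) set" where
  "Ext1_zero C M N = {(i, p) \<in> extensions C M N. \<exists>s\<in>Hom C M (tgt C i). p \<cdot>\<^bsub>C\<^esub> s = ident C M}"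

locale finitary_abelian_category = abelian_category +
  assumes finite_Hom: "\<lbrakk>M \<in> Ob C; N \<in> Ob C\<rbrakk> \<Longrightarrow> finite (Hom C M N)"
    and finite_Ext1: "\<lbrakk>M \<in> Ob C; N \<in> Ob C\<rbrakk> \<Longrightarrow> finite (Ext1 C M N)"


section \<open>Subobjects and factorizing sequences\<close>

text \<open>
  A subobject of \<open>K\<close> is an equivalence class of monomorphisms into \<open>K\<close>. Its object, and the
  corresponding quotient of \<open>K\<close>, are determined up to isomorphism only;
  \<open>sub_objects C U\<close> and \<open>quot_objects C U\<close> consist of all representatives and are hence full
  isomorphism classes.
\<close>

definition subobject_equiv :: "('o, 'm) preadd_cat \<Rightarrow> 'o \<Rightarrow> ('m \<times> 'm) set" where
  "subobject_equiv C K = {(u, v). is_mono C u \<and> tgt C u = K \<and> is_mono C v \<and> tgt C v = K \<and>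
     (\<exists>w\<in>Hom C (src C u) (src C v). is_iso C w \<and> v \<cdot>\<^bsub>C\<^esub> w = u)}"

definition subobjects :: "('o, 'm) preadd_cat \<Rightarrow> 'o \<Rightarrow> 'm set set" where
  "subobjects C K = {u. is_mono C u \<and> tgt C u = K} // subobject_equiv C K"

definition sub_objects :: "('o, 'm) preadd_cat \<Rightarrow> 'm set \<Rightarrow> 'o set" where
  "sub_objects C U = src C ` U"

definition quot_objects :: "('o, 'm) preadd_cat \<Rightarrow> 'm set \<Rightarrow> 'o set" where
  "quot_objects C U = {tgt C q | q. \<exists>u\<in>U. is_cokernel C q u}"

text \<open>Full subcategories are represented by their sets of objects.\<close>

definition extension_closed :: "('o, 'm) preadd_cat \<Rightarrow> 'o set \<Rightarrow> bool" where
  "extension_closed C S \<longleftrightarrow> S \<subseteq> Ob C \<and>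
     (\<forall>i p. short_exact C i p \<and> src C i \<in> S \<and> tgt C p \<in> S \<longrightarrow> tgt C i \<in> S)"

definition additive_subcategory :: "('o, 'm) preadd_cat \<Rightarrow> 'o set \<Rightarrow> bool" where
  "additive_subcategory C S \<longleftrightarrow> S \<subseteq> Ob C \<and> (\<exists>Z\<in>S. is_zero_object C Z) \<and>
     (\<forall>X\<in>S. \<forall>Y\<in>S. \<exists>P\<in>S. is_biproduct C X Y P)"

text \<open>
  \<open>generated_subcategory C B Ss\<close> is the minimal additive subcategory of \<open>B\<close> which contains all
  members of \<open>Ss\<close> and is closed under extensions. (A set \<open>T\<close> with a zero object that is closed
  under extensions is closed under isomorphism, so the intersection is again of this kind.)
\<close>

definition generated_subcategory ::
    "('o, 'm) preadd_cat \<Rightarrow> 'o set \<Rightarrow> 'o set list \<Rightarrow> 'o set" where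
  "generated_subcategory C B Ss = {X \<in> B. \<forall>T. T \<subseteq> B \<and> additive_subcategory C T \<and>
     extension_closed C T \<and> \<Union> (set Ss) \<subseteq> T \<longrightarrow> X \<in> T}"

text \<open>
  No closure under isomorphism is required of \<open>S'\<close> and \<open>S''\<close>: if \<open>B\<close> has a zero object, so do
  \<open>S'\<close> and \<open>S''\<close>, and closure under isomorphism follows from closure under extensions.
\<close>

definition factorizing_pair ::
    "('o, 'm) preadd_cat \<Rightarrow> 'o set \<Rightarrow> 'o set \<Rightarrow> 'o set \<Rightarrow> bool" where
  "factorizing_pair C B S' S'' \<longleftrightarrow>
     S' \<subseteq> B \<and> S'' \<subseteq> B \<and> extension_closed C S' \<and> extension_closed C S'' \<and>
     (\<forall>M\<in>B. \<exists>!U. U \<in> subobjects C M \<and> sub_objects C U \<inter> S'' \<noteq> {} \<and> quot_objects C U \<inter> S' \<noteq> {})"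

inductive factorizing_sequence :: "('o, 'm) preadd_cat \<Rightarrow> 'o set \<Rightarrow> 'o set list \<Rightarrow> bool"
  for C :: "('o, 'm) preadd_cat" where
  pair: "factorizing_pair C B S' S'' \<Longrightarrow> factorizing_sequence C B [S', S'']"
| snoc: "\<lbrakk>length Ss \<ge> 2; factorizing_sequence C (generated_subcategory C B Ss) Ss;
          factorizing_pair C B (generated_subcategory C B Ss) S\<rbrakk>
         \<Longrightarrow> factorizing_sequence C B (Ss @ [S])"


section \<open>Vector spaces over the rationals\<close>

text \<open>
  Vector spaces are records of type \<^typ>\<open>(rat, 'v) module\<close>. Where only the vector space structure
  is meant, the ring multiplication and unit inherited by that record type are left undefined.
\<close>

definition rat_field :: "rat ring" where
  "rat_field = \<lparr>carrier = UNIV, monoid.mult = (*), one = 1, zero = 0, add = (+)\<rparr>"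

definition free_space :: "'b set \<Rightarrow> (rat, 'b \<Rightarrow> rat) module" where
  "free_space B = \<lparr>carrier = {f. finite {b. f b \<noteq> 0} \<and> {b. f b \<noteq> 0} \<subseteq> B},
     monoid.mult = undefined, one = undefined,
     zero = (\<lambda>b. 0), add = (\<lambda>f g b. f b + g b), smult = (\<lambda>c f b. c * f b)\<rparr>"

definition quotient_space :: "(rat, 'v) module \<Rightarrow> 'v set \<Rightarrow> (rat, 'v set) module" where
  "quotient_space V R = \<lparr>carrier = a_rcosets\<^bsub>V\<^esub> R,
     monoid.mult = undefined, one = undefined,
     zero = R, add = set_add V, smult = (\<lambda>c X. \<Union>x\<in>X. R +>\<^bsub>V\<^esub> (c \<odot>\<^bsub>V\<^esub> x))\<rparr>"

definition span_in :: "(rat, 'v) module \<Rightarrow> 'v set \<Rightarrow> 'v set" where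
  "span_in V G = \<Inter> {W. submodule W rat_field V \<and> G \<subseteq> W}"

definition single :: "'b \<Rightarrow> 'b \<Rightarrow> rat" where
  "single b = (\<lambda>x. if x = b then 1 else 0)"

text \<open>
  The tensor product of \<open>V\<^sub>1, \<dots>, V\<^sub>m\<close>: the space freely spanned by the tuples in
  \<open>V\<^sub>1 \<times> \<dots> \<times> V\<^sub>m\<close>, modulo the relations expressing additivity and homogeneity in each argument.
\<close>

definition tensor_relations :: "(rat, 'v) module list \<Rightarrow> ('v list \<Rightarrow> rat) set" where
  "tensor_relations Vs =
     {(\<lambda>t. single (vs[i := x \<oplus>\<^bsub>Vs ! i\<^esub> y]) t - single (vs[i := x]) t - single (vs[i := y]) t)
       | vs i x y. vs \<in> listset (map carrier Vs) \<and> i < length Vs \<and>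
           x \<in> carrier (Vs ! i) \<and> y \<in> carrier (Vs ! i)} \<union>
     {(\<lambda>t. single (vs[i := c \<odot>\<^bsub>Vs ! i\<^esub> x]) t - c * single (vs[i := x]) t)
       | vs i c x. vs \<in> listset (map carrier Vs) \<and> i < length Vs \<and> x \<in> carrier (Vs ! i)}"

definition tensor_product :: "(rat, 'v) module list \<Rightarrow> (rat, ('v list \<Rightarrow> rat) set) module" where
  "tensor_product Vs =
     (let F = free_space (listset (map carrier Vs))
      in quotient_space F (span_in F (tensor_relations Vs)))"

definition isomorphic_spaces :: "(rat, 'v) module \<Rightarrow> (rat, 'w) module \<Rightarrow> bool" where
  "isomorphic_spaces V W \<longleftrightarrow> (\<exists>\<phi>. bij_betw \<phi> (carrier V) (carrier W) \<and>
     (\<forall>x\<in>carrier V. \<forall>y\<in>carrier V. \<phi> (x \<oplus>\<^bsub>V\<^esub> y) = \<phi> x \<oplus>\<^bsub>W\<^esub> \<phi> y) \<and>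
     (\<forall>c. \<forall>x\<in>carrier V. \<phi> (c \<odot>\<^bsub>V\<^esub> x) = c \<odot>\<^bsub>W\<^esub> \<phi> x))"


section \<open>Hall algebras\<close>

definition iso_class :: "('o, 'm) preadd_cat \<Rightarrow> 'o \<Rightarrow> 'o set" where
  "iso_class C X = {Y \<in> Ob C. isomorphic C X Y}"

definition Iso :: "('o, 'm) preadd_cat \<Rightarrow> 'o set \<Rightarrow> 'o set set" where
  "Iso C S = iso_class C ` S"

text \<open>
  \<open>hall_number C M N K\<close> is the structure constant \<open>F\<^bsub>MN\<^esub>\<^bsup>K\<^esup>\<close>, for isomorphism classes \<open>M\<close>, \<open>N\<close>
  and \<open>K\<close>. In a finitary category the set counted here is finite.
\<close>

definition hall_number :: "('o, 'm) preadd_cat \<Rightarrow> 'o set \<Rightarrow> 'o set \<Rightarrow> 'o set \<Rightarrow> nat" where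
  "hall_number C M N K =
     card {U \<in> subobjects C (SOME X. X \<in> K). sub_objects C U = N \<and> quot_objects C U = M}"

text \<open>
  Elements of the Hall algebra, and more generally formal infinite sums of isomorphism classes,
  are given by their families of coefficients. The completion of the Hall algebra with respect to
  the grading by the Grothendieck group is a space of such formal sums, and it consists of all of
  them if every homogeneous component is finite-dimensional; without that condition the formal sum
  of all isomorphism classes need not have homogeneous components in the Hall algebra.

  The product of two formal sums is computed coefficientwise. It is defined if only finitely many
  pairs of classes contribute to each coefficient, which is always the case for finitely
  supported families over a finitary category.
\<close>

definition hall_terms :: "('o, 'm) preadd_cat \<Rightarrow> ('o set \<Rightarrow> rat) \<Rightarrow> ('o set \<Rightarrow> rat) \<Rightarrow> 'o set
    \<Rightarrow> ('o set \<times> 'o set) set" where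
  "hall_terms C f g K = {(M, N) \<in> Iso C (Ob C) \<times> Iso C (Ob C).
     f M * g N * of_nat (hall_number C M N K) \<noteq> 0}"

definition hall_mult_defined ::
    "('o, 'm) preadd_cat \<Rightarrow> ('o set \<Rightarrow> rat) \<Rightarrow> ('o set \<Rightarrow> rat) \<Rightarrow> bool" where
  "hall_mult_defined C f g \<longleftrightarrow> (\<forall>K\<in>Iso C (Ob C). finite (hall_terms C f g K))"

definition hall_mult ::
    "('o, 'm) preadd_cat \<Rightarrow> ('o set \<Rightarrow> rat) \<Rightarrow> ('o set \<Rightarrow> rat) \<Rightarrow> 'o set \<Rightarrow> rat" where
  "hall_mult C f g = (\<lambda>K. if K \<in> Iso C (Ob C)
     then (\<Sum>(M, N)\<in>hall_terms C f g K. f M * g N * of_nat (hall_number C M N K)) else 0)"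

text \<open>Products of several factors are bracketed to the left: \<open>((f g\<^sub>1) g\<^sub>2) \<dots>\<close>.\<close>

primrec hall_prod ::
    "('o, 'm) preadd_cat \<Rightarrow> ('o set \<Rightarrow> rat) \<Rightarrow> ('o set \<Rightarrow> rat) list \<Rightarrow> 'o set \<Rightarrow> rat" where
  "hall_prod C f [] = f"
| "hall_prod C f (g # gs) = hall_prod C (hall_mult C f g) gs"

primrec hall_prod_defined ::
    "('o, 'm) preadd_cat \<Rightarrow> ('o set \<Rightarrow> rat) \<Rightarrow> ('o set \<Rightarrow> rat) list \<Rightarrow> bool" where
  "hall_prod_defined C f [] \<longleftrightarrow> True"
| "hall_prod_defined C f (g # gs) \<longleftrightarrow>
     hall_mult_defined C f g \<and> hall_prod_defined C (hall_mult C f g) gs"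

definition Exp :: "('o, 'm) preadd_cat \<Rightarrow> 'o set \<Rightarrow> 'o set \<Rightarrow> rat" where
  "Exp C S = (\<lambda>X. if X \<in> Iso C S then 1 else 0)"

text \<open>
  \<open>hall_algebra C S\<close> is the subalgebra spanned by the classes of objects of the full subcategory
  \<open>S\<close>; the full Hall algebra is \<open>hall_algebra C (Ob C)\<close>.
\<close>

definition hall_algebra :: "('o, 'm) preadd_cat \<Rightarrow> 'o set \<Rightarrow> (rat, 'o set \<Rightarrow> rat) module" where
  "hall_algebra C S = (free_space (Iso C S))
     \<lparr>monoid.mult := hall_mult C, one := single {Z. is_zero_object C Z}\<rparr>"

end

theory Submission
  imports Defs
begin

text \<open>
  For a factorizing pair \<open>(S', S'')\<close> of \<open>B\<close>, the coefficient of \<open>[K]\<close> in the product of the two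
  exponentials counts the subobjects of \<open>K\<close> in \<open>S''\<close> with quotient in \<open>S'\<close>. There is exactly one for
  \<open>K\<close> in \<open>B\<close>, and none otherwise because \<open>B\<close> is closed under extensions. Part (a) follows by induction.

  For part (b), vanishing of \<open>Ext\<^sup>1(-, N)\<close> passes to extensions, hence to all objects of
  \<open>A\<^bsub>\<le>m-1\<^esub>\<close>. Every object is then the direct sum of its sub and its quotient, so sending \<open>K\<close> to the two
  classes is a bijection of isomorphism classes, and by induction \<open>Iso A\<close> is in bijection with the
  product of the \<open>Iso A\<^sub>i\<close>. This product indexes a basis of the tensor product.
\<close>

section \<open>Morphisms in preadditive and abelian categories\<close>

text \<open>The obstacle is that a subobject is a class of monomorphisms, and its object and
  quotient are known only up to isomorphism. The relation \<open>extends C M N E\<close> forgets the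
  arrows and records only that some sequence 0 -> N -> E -> M -> 0 is exact. It is invariant under
  isomorphism in all three places, and uniqueness of the factorization becomes uniqueness of the
  classes of N and M. Vanishing of Ext^1 is recast in the same spirit as
  \<open>splitting_pair\<close>: every such sequence has a section. That this passes to an extension
  M of M' by M'' is exactness of Ext^1(M', N) -> Ext^1(M, N) -> Ext^1(M'', N) at the middle term,
  carried out with explicit arrows. The factorizations themselves exhibit each object as an iterated
  extension of members of the sequence, so the vanishing reaches all of them. For the tensor
  product, a multilinear coordinate map \<open>\<Phi>\<close> on formal sums of tuples annihilates
  the defining relations; a right inverse \<open>\<sigma>\<close> of \<open>\<Phi>\<close> shows
  that its kernel is no larger than their span.\<close>

context preadditive_category
begin

section \<open>Hom groups and composition with zero\<close>

lemma HomD: "f \<in> Hom C X Y \<Longrightarrow> f \<in> Ar C" "f \<in> Hom C X Y \<Longrightarrow> src C f = X"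
  "f \<in> Hom C X Y \<Longrightarrow> tgt C f = Y" "f \<in> Hom C X Y \<Longrightarrow> X \<in> Ob C" "f \<in> Hom C X Y \<Longrightarrow> Y \<in> Ob C"
  using src_closed tgt_closed by (auto simp: Hom_def)

lemma HomI: "f \<in> Ar C \<Longrightarrow> f \<in> Hom C (src C f) (tgt C f)"
  by (simp add: Hom_def)

lemma zero_closed: "X \<in> Ob C \<Longrightarrow> Y \<in> Ob C \<Longrightarrow> zero_ar C X Y \<in> Hom C X Y"
  using monoid.one_closed[OF group.is_monoid[OF comm_group.axioms(2)[OF hom_group]]] by simp

lemma add_closed: "f \<in> Hom C X Y \<Longrightarrow> g \<in> Hom C X Y \<Longrightarrow> add_ar C f g \<in> Hom C X Y"
  using monoid.m_closed[OF group.is_monoid[OF comm_group.axioms(2)[OF hom_group]]]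
  by (metis HomD(4,5) monoid.select_convs(1) partial_object.select_convs(1))

lemma add_zero:
  assumes "f \<in> Hom C X Y"
  shows "add_ar C f (zero_ar C X Y) = f" "add_ar C (zero_ar C X Y) f = f"
proof -
  interpret comm_group "\<lparr>carrier = Hom C X Y, monoid.mult = add_ar C, one = zero_ar C X Y\<rparr>"
    using assms HomD hom_group by blast
  show "add_ar C f (zero_ar C X Y) = f" "add_ar C (zero_ar C X Y) f = f"
    using r_one[of f] l_one[of f] assms by simp_all
qed

lemma add_cancel_right:
  assumes "f \<in> Hom C X Y" "g \<in> Hom C X Y" "h \<in> Hom C X Y" "add_ar C f h = add_ar C g h"
  shows "f = g"
proof -
  interpret comm_group "\<lparr>carrier = Hom C X Y, monoid.mult = add_ar C, one = zero_ar C X Y\<rparr>"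
    using assms HomD hom_group by blast
  show ?thesis using right_cancel[of h f g] assms by simp
qed

text \<open>Subtraction enters only through d + g = f, so additive inverses of morphisms never need
  a name of their own.\<close>

lemma ex_difference:
  assumes "f \<in> Hom C X Y" "g \<in> Hom C X Y"
  shows "\<exists>d\<in>Hom C X Y. add_ar C d g = f"
proof -
  let ?G = "\<lparr>carrier = Hom C X Y, monoid.mult = add_ar C, one = zero_ar C X Y\<rparr>"
  interpret comm_group ?G
    using assms HomD hom_group by blast
  have "(f \<otimes>\<^bsub>?G\<^esub> inv\<^bsub>?G\<^esub> g) \<otimes>\<^bsub>?G\<^esub> g = f" "f \<otimes>\<^bsub>?G\<^esub> inv\<^bsub>?G\<^esub> g \<in> carrier ?G"
    using assms inv_closed[of g] m_closed[of f "inv\<^bsub>?G\<^esub> g"] m_assoc[of f "inv\<^bsub>?G\<^esub> g" g]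
      l_inv[of g] r_one[of f] by simp_all
  then show ?thesis by (metis monoid.select_convs(1) partial_object.select_convs(1))
qed

text \<open>The composite plus itself is itself, because zero plus zero is zero; cancelling in the
  group of morphisms leaves zero.\<close>

lemma comp_zero_right:
  assumes "g \<in> Hom C Y Z" "X \<in> Ob C"
  shows "g \<cdot> zero_ar C X Y = zero_ar C X Z"
proof -
  have z: "zero_ar C X Y \<in> Hom C X Y" "zero_ar C X Z \<in> Hom C X Z"
    using assms HomD zero_closed by blast+
  have c: "g \<cdot> zero_ar C X Y \<in> Hom C X Z" using z assms comp_closed by blast
  have "add_ar C (g \<cdot> zero_ar C X Y) (g \<cdot> zero_ar C X Y) = add_ar C (zero_ar C X Z) (g \<cdot> zero_ar C X Y)"
    using comp_add_right[OF z(1) z(1) assms(1)] add_zero[OF z(1)] add_zero[OF c] by simp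
  then show ?thesis using add_cancel_right c z by blast
qed

lemma comp_zero_left:
  assumes "f \<in> Hom C X Y" "Z \<in> Ob C"
  shows "zero_ar C Y Z \<cdot> f = zero_ar C X Z"
proof -
  have z: "zero_ar C Y Z \<in> Hom C Y Z" "zero_ar C X Z \<in> Hom C X Z"
    using assms HomD zero_closed by blast+
  have c: "zero_ar C Y Z \<cdot> f \<in> Hom C X Z" using z assms comp_closed by blast
  have "add_ar C (zero_ar C Y Z \<cdot> f) (zero_ar C Y Z \<cdot> f) = add_ar C (zero_ar C X Z) (zero_ar C Y Z \<cdot> f)"
    using comp_add_left[OF assms(1) z(1) z(1)] add_zero[OF z(1)] add_zero[OF c] by simp
  then show ?thesis using add_cancel_right c z by blast
qed

section \<open>Monomorphisms and epimorphisms via zero composites\<close>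

lemma is_monoD:
  "\<lbrakk>is_mono C u; u \<in> Hom C X Y; f \<in> Hom C W X; g \<in> Hom C W X; u \<cdot> f = u \<cdot> g\<rbrakk> \<Longrightarrow> f = g"
  unfolding is_mono_def by (metis HomD(2,4))

lemma is_epiD:
  "\<lbrakk>is_epi C q; q \<in> Hom C X Y; f \<in> Hom C Y W; g \<in> Hom C Y W; f \<cdot> q = g \<cdot> q\<rbrakk> \<Longrightarrow> f = g"
  unfolding is_epi_def by (metis HomD(3,5))

text \<open>By \<open>ex_difference\<close>, two morphisms with equal composites differ by one with
  zero composite. This form suits kernels, whose universal property speaks only of zero
  composites.\<close>

lemma is_mono_iff_zero:
  assumes u: "u \<in> Hom C X Y"
  shows "is_mono C u \<longleftrightarrow> (\<forall>W\<in>Ob C. \<forall>h\<in>Hom C W X. u \<cdot> h = zero_ar C W Y \<longrightarrow> h = zero_ar C W X)"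
    (is "_ \<longleftrightarrow> ?R")
proof
  assume "is_mono C u"
  then show ?R using is_monoD[OF _ u] comp_zero_right[OF u] zero_closed HomD u by metis
next
  assume R: ?R
  show "is_mono C u"
    unfolding is_mono_def
  proof (intro conjI ballI impI)
    show "u \<in> Ar C" using u HomD by blast
  next
    fix W f g assume W: "W \<in> Ob C" and "f \<in> Hom C W (src C u)" "g \<in> Hom C W (src C u)"
      and eq: "u \<cdot> f = u \<cdot> g"
    then have fg: "f \<in> Hom C W X" "g \<in> Hom C W X" using u HomD by auto
    obtain d where d: "d \<in> Hom C W X" "add_ar C d g = f" using ex_difference fg by blast
    have z: "zero_ar C W Y \<in> Hom C W Y" using W u HomD zero_closed by blast
    have ug: "u \<cdot> g \<in> Hom C W Y" "u \<cdot> d \<in> Hom C W Y" using comp_closed u fg d by blast+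
    have "add_ar C (u \<cdot> d) (u \<cdot> g) = add_ar C (zero_ar C W Y) (u \<cdot> g)"
      using comp_add_right[OF d(1) fg(2) u] d eq add_zero ug by simp
    then have "u \<cdot> d = zero_ar C W Y" using add_cancel_right ug z by blast
    then have "d = zero_ar C W X" using R W d by blast
    then show "f = g" using d add_zero fg by auto
  qed
qed

lemma is_epi_iff_zero:
  assumes q: "q \<in> Hom C X Y"
  shows "is_epi C q \<longleftrightarrow> (\<forall>W\<in>Ob C. \<forall>h\<in>Hom C Y W. h \<cdot> q = zero_ar C X W \<longrightarrow> h = zero_ar C Y W)"
    (is "_ \<longleftrightarrow> ?R")
proof
  assume "is_epi C q"
  then show ?R using is_epiD[OF _ q] comp_zero_left[OF q] zero_closed HomD q by metis
next
  assume R: ?R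
  show "is_epi C q"
    unfolding is_epi_def
  proof (intro conjI ballI impI)
    show "q \<in> Ar C" using q HomD by blast
  next
    fix W f g assume W: "W \<in> Ob C" and "f \<in> Hom C (tgt C q) W" "g \<in> Hom C (tgt C q) W"
      and eq: "f \<cdot> q = g \<cdot> q"
    then have fg: "f \<in> Hom C Y W" "g \<in> Hom C Y W" using q HomD by auto
    obtain d where d: "d \<in> Hom C Y W" "add_ar C d g = f" using ex_difference fg by blast
    have z: "zero_ar C X W \<in> Hom C X W" using W q HomD zero_closed by blast
    have ug: "g \<cdot> q \<in> Hom C X W" "d \<cdot> q \<in> Hom C X W" using comp_closed q fg d by blast+
    have "add_ar C (d \<cdot> q) (g \<cdot> q) = add_ar C (zero_ar C X W) (g \<cdot> q)"
      using comp_add_left[OF q d(1) fg(2)] d eq add_zero ug by simp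
    then have "d \<cdot> q = zero_ar C X W" using add_cancel_right ug z by blast
    then have "d = zero_ar C Y W" using R W d by blast
    then show "f = g" using d add_zero fg by auto
  qed
qed

section \<open>Isomorphisms and isomorphism classes\<close>

lemma is_isoE:
  assumes "is_iso C f" "f \<in> Hom C X Y"
  obtains g where "g \<in> Hom C Y X" "g \<cdot> f = ident C X" "f \<cdot> g = ident C Y" "is_iso C g"
proof -
  obtain g where g: "g \<in> Hom C Y X" "g \<cdot> f = ident C X" "f \<cdot> g = ident C Y"
    using assms HomD unfolding is_iso_def by metis
  have "is_iso C g" unfolding is_iso_def using g assms(2) HomD by metis
  then show ?thesis using that g by blast
qed

lemma is_isoI:
  assumes "f \<in> Hom C X Y" "g \<in> Hom C Y X" "g \<cdot> f = ident C X" "f \<cdot> g = ident C Y"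
  shows "is_iso C f"
  unfolding is_iso_def using assms HomD by metis

lemma ident_iso: "X \<in> Ob C \<Longrightarrow> is_iso C (ident C X)"
  using is_isoI ident_closed ident_left by blast

lemma comp_iso:
  assumes "is_iso C f" "f \<in> Hom C X Y" "is_iso C g" "g \<in> Hom C Y Z"
  shows "is_iso C (g \<cdot> f)"
proof -
  obtain f' where f': "f' \<in> Hom C Y X" "f' \<cdot> f = ident C X" "f \<cdot> f' = ident C Y"
    using is_isoE assms by metis
  obtain g' where g': "g' \<in> Hom C Z Y" "g' \<cdot> g = ident C Y" "g \<cdot> g' = ident C Z"
    using is_isoE assms by metis
  have gf: "g \<cdot> f \<in> Hom C X Z" and fg: "f' \<cdot> g' \<in> Hom C Z X"
    using comp_closed assms f' g' by blast+
  have "(f' \<cdot> g') \<cdot> (g \<cdot> f) = f' \<cdot> (g' \<cdot> (g \<cdot> f))" using comp_assoc gf g' f' by blast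
  also have "g' \<cdot> (g \<cdot> f) = (g' \<cdot> g) \<cdot> f" using comp_assoc assms g' by metis
  finally have 1: "(f' \<cdot> g') \<cdot> (g \<cdot> f) = ident C X" using g' f' ident_left assms by simp
  have "(g \<cdot> f) \<cdot> (f' \<cdot> g') = g \<cdot> (f \<cdot> (f' \<cdot> g'))" using comp_assoc fg assms by blast
  also have "f \<cdot> (f' \<cdot> g') = (f \<cdot> f') \<cdot> g'" using comp_assoc assms f' g' by metis
  finally have 2: "(g \<cdot> f) \<cdot> (f' \<cdot> g') = ident C Z" using g' f' ident_left by simp
  show ?thesis using is_isoI gf fg 1 2 by blast
qed

lemma isomorphic_refl: "X \<in> Ob C \<Longrightarrow> isomorphic C X X"
  unfolding isomorphic_def using ident_iso ident_closed by blast

lemma isomorphic_sym: "isomorphic C X Y \<Longrightarrow> isomorphic C Y X"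
  unfolding isomorphic_def using is_isoE by metis

lemma isomorphic_trans: "isomorphic C X Y \<Longrightarrow> isomorphic C Y Z \<Longrightarrow> isomorphic C X Z"
  unfolding isomorphic_def using comp_iso comp_closed by metis

lemma iso_class_eq_iff: "X \<in> Ob C \<Longrightarrow> iso_class C X = iso_class C Y \<longleftrightarrow> isomorphic C X Y"
  unfolding iso_class_def using isomorphic_refl isomorphic_sym isomorphic_trans by blast

text \<open>Bridges two encodings: \<open>factorizing_pair\<close> asks that a class meet a
  subcategory, while \<open>Exp\<close> and \<open>hall_number\<close> compare whole
  classes.\<close>

lemma iso_class_Iso_iff:
  assumes "X \<in> Ob C" "S \<subseteq> Ob C"
  shows "iso_class C X \<in> Iso C S \<longleftrightarrow> iso_class C X \<inter> S \<noteq> {}"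
proof
  assume "iso_class C X \<in> Iso C S"
  then obtain Y where "Y \<in> S" "iso_class C X = iso_class C Y" by (auto simp: Iso_def)
  then show "iso_class C X \<inter> S \<noteq> {}"
    using assms isomorphic_refl by (auto simp: iso_class_def)
next
  assume "iso_class C X \<inter> S \<noteq> {}"
  then obtain Y where "Y \<in> S" "isomorphic C X Y" by (auto simp: iso_class_def)
  then show "iso_class C X \<in> Iso C S" using iso_class_eq_iff[OF assms(1)] by (auto simp: Iso_def)
qed

lemma iso_is_mono:
  assumes "is_iso C w" "w \<in> Hom C X Y" shows "is_mono C w"
proof -
  obtain v where v: "v \<in> Hom C Y X" "v \<cdot> w = ident C X" using is_isoE assms by metis
  show ?thesis unfolding is_mono_def
    using v assms comp_assoc[of _ _ X w Y v X] ident_left HomD by metis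
qed

lemma iso_is_epi:
  assumes "is_iso C w" "w \<in> Hom C X Y" shows "is_epi C w"
proof -
  obtain v where v: "v \<in> Hom C Y X" "w \<cdot> v = ident C Y" using is_isoE assms by metis
  show ?thesis unfolding is_epi_def
    using v assms comp_assoc[of v Y X w Y] ident_right HomD by metis
qed

lemma comp_mono:
  assumes "is_mono C u" "u \<in> Hom C X Y" "is_mono C v" "v \<in> Hom C Y Z"
  shows "is_mono C (v \<cdot> u)"
proof -
  have vu: "v \<cdot> u \<in> Hom C X Z" using assms comp_closed by blast
  show ?thesis unfolding is_mono_def
  proof (intro conjI ballI impI)
    show "v \<cdot> u \<in> Ar C" using vu HomD by blast
  next
    fix W f g assume "W \<in> Ob C" "f \<in> Hom C W (src C (v \<cdot> u))" "g \<in> Hom C W (src C (v \<cdot> u))"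
      and eq: "(v \<cdot> u) \<cdot> f = (v \<cdot> u) \<cdot> g"
    then have fg: "f \<in> Hom C W X" "g \<in> Hom C W X" using vu HomD by auto
    have "v \<cdot> (u \<cdot> f) = v \<cdot> (u \<cdot> g)" using eq comp_assoc assms fg by metis
    then have "u \<cdot> f = u \<cdot> g" using is_monoD[OF assms(3,4)] comp_closed fg assms by blast
    then show "f = g" using is_monoD[OF assms(1,2)] fg by blast
  qed
qed

lemma comp_epi:
  assumes "is_epi C u" "u \<in> Hom C X Y" "is_epi C v" "v \<in> Hom C Y Z"
  shows "is_epi C (v \<cdot> u)"
proof -
  have vu: "v \<cdot> u \<in> Hom C X Z" using assms comp_closed by blast
  show ?thesis unfolding is_epi_def
  proof (intro conjI ballI impI)
    show "v \<cdot> u \<in> Ar C" using vu HomD by blast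
  next
    fix W f g assume "W \<in> Ob C" "f \<in> Hom C (tgt C (v \<cdot> u)) W" "g \<in> Hom C (tgt C (v \<cdot> u)) W"
      and eq: "f \<cdot> (v \<cdot> u) = g \<cdot> (v \<cdot> u)"
    then have fg: "f \<in> Hom C Z W" "g \<in> Hom C Z W" using vu HomD by auto
    have "(f \<cdot> v) \<cdot> u = (g \<cdot> v) \<cdot> u" using eq comp_assoc assms fg by metis
    then have "f \<cdot> v = g \<cdot> v" using is_epiD[OF assms(1,2)] comp_closed fg assms by blast
    then show "f = g" using is_epiD[OF assms(3,4)] fg by blast
  qed
qed

section \<open>Kernels and cokernels\<close>

lemma is_kernelE:
  assumes "is_kernel C k f" "f \<in> Hom C Y Z"
  obtains X where "X = src C k" "k \<in> Hom C X Y" "f \<cdot> k = zero_ar C X Z" "is_mono C k"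
    "\<And>W h. h \<in> Hom C W Y \<Longrightarrow> f \<cdot> h = zero_ar C W Z \<Longrightarrow> \<exists>l\<in>Hom C W X. k \<cdot> l = h"
proof -
  define X where "X = src C k"
  have k: "k \<in> Hom C X Y" "f \<cdot> k = zero_ar C X Z"
    using assms unfolding is_kernel_def X_def Hom_def by auto
  have u: "\<exists>!l. l \<in> Hom C W X \<and> k \<cdot> l = h" if "h \<in> Hom C W Y" "f \<cdot> h = zero_ar C W Z" for W h
  proof -
    have "src C f = Y" "tgt C f = Z" "W \<in> Ob C" using assms(2) that(1) HomD by blast+
    then show ?thesis using assms(1) that unfolding is_kernel_def X_def by simp
  qed
  have "is_mono C k" unfolding is_mono_iff_zero[OF k(1)]
  proof (intro ballI impI)
    fix W h assume W: "W \<in> Ob C" and h: "h \<in> Hom C W X" "k \<cdot> h = zero_ar C W Y"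
    have z: "zero_ar C W Y \<in> Hom C W Y" "zero_ar C W X \<in> Hom C W X" by (simp_all add: zero_closed W HomD(4,5)[OF k(1)])
    have "f \<cdot> zero_ar C W Y = zero_ar C W Z" using comp_zero_right assms W by blast
    \<comment> \<open>Both \<open>h\<close> and the zero morphism factor zero through
      \<open>k\<close>, so uniqueness identifies them.\<close>
    then show "h = zero_ar C W X" using u[OF z(1)] h z comp_zero_right[OF k(1) W] by auto
  qed
  then show ?thesis
    by (rule that[OF X_def k]) (use u in \<open>blast dest: ex1_implies_ex\<close>)
qed

lemma is_cokernelE:
  assumes "is_cokernel C q f" "f \<in> Hom C X Y"
  obtains Z where "Z = tgt C q" "q \<in> Hom C Y Z" "q \<cdot> f = zero_ar C X Z" "is_epi C q"
    "\<And>W h. h \<in> Hom C Y W \<Longrightarrow> h \<cdot> f = zero_ar C X W \<Longrightarrow> \<exists>l\<in>Hom C Z W. l \<cdot> q = h"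
proof -
  define Z where "Z = tgt C q"
  have q: "q \<in> Hom C Y Z" "q \<cdot> f = zero_ar C X Z"
    using assms unfolding is_cokernel_def Z_def Hom_def by auto
  have u: "\<exists>!l. l \<in> Hom C Z W \<and> l \<cdot> q = h" if "h \<in> Hom C Y W" "h \<cdot> f = zero_ar C X W" for W h
  proof -
    have "src C f = X" "tgt C f = Y" "W \<in> Ob C" using assms(2) that(1) HomD by blast+
    then show ?thesis using assms(1) that unfolding is_cokernel_def Z_def by simp
  qed
  have "is_epi C q" unfolding is_epi_iff_zero[OF q(1)]
  proof (intro ballI impI)
    fix W h assume W: "W \<in> Ob C" and h: "h \<in> Hom C Z W" "h \<cdot> q = zero_ar C Y W"
    have z: "zero_ar C Y W \<in> Hom C Y W" "zero_ar C Z W \<in> Hom C Z W" by (simp_all add: zero_closed W HomD(4,5)[OF q(1)])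
    have "zero_ar C Y W \<cdot> f = zero_ar C X W" using comp_zero_left assms W by blast
    then show "h = zero_ar C Z W" using u[OF z(1)] h z comp_zero_left[OF q(1) W] by auto
  qed
  then show ?thesis
    by (rule that[OF Z_def q]) (use u in \<open>blast dest: ex1_implies_ex\<close>)
qed

text \<open>Uniqueness of the factorization is exchanged for the monomorphism property, which
  composes and can be tested on zero composites.\<close>

lemma is_kernelI:
  assumes "k \<in> Hom C X Y" "f \<in> Hom C Y Z" "f \<cdot> k = zero_ar C X Z" "is_mono C k"
    "\<And>W h. W \<in> Ob C \<Longrightarrow> h \<in> Hom C W Y \<Longrightarrow> f \<cdot> h = zero_ar C W Z \<Longrightarrow> \<exists>l\<in>Hom C W X. k \<cdot> l = h"
  shows "is_kernel C k f"
  unfolding is_kernel_def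
proof (intro conjI ballI impI)
  fix W h assume W: "W \<in> Ob C" "h \<in> Hom C W (src C f)" "f \<cdot> h = zero_ar C W (tgt C f)"
  then have "\<exists>l\<in>Hom C W X. k \<cdot> l = h" using assms HomD by metis
  moreover have "l = l'" if "l \<in> Hom C W X" "l' \<in> Hom C W X" "k \<cdot> l = k \<cdot> l'" for l l'
    using is_monoD assms that by blast
  ultimately show "\<exists>!l. l \<in> Hom C W (src C k) \<and> k \<cdot> l = h" using assms(1) HomD(2) by metis
qed (use assms HomD in auto)

lemma is_cokernelI:
  assumes "q \<in> Hom C Y Z" "f \<in> Hom C X Y" "q \<cdot> f = zero_ar C X Z" "is_epi C q"
    "\<And>W h. W \<in> Ob C \<Longrightarrow> h \<in> Hom C Y W \<Longrightarrow> h \<cdot> f = zero_ar C X W \<Longrightarrow> \<exists>l\<in>Hom C Z W. l \<cdot> q = h"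
  shows "is_cokernel C q f"
  unfolding is_cokernel_def
proof (intro conjI ballI impI)
  fix W h assume W: "W \<in> Ob C" "h \<in> Hom C (tgt C f) W" "h \<cdot> f = zero_ar C (src C f) W"
  then have "\<exists>l\<in>Hom C Z W. l \<cdot> q = h" using assms HomD by metis
  moreover have "l = l'" if "l \<in> Hom C Z W" "l' \<in> Hom C Z W" "l \<cdot> q = l' \<cdot> q" for l l'
    using is_epiD assms that by blast
  ultimately show "\<exists>!l. l \<in> Hom C (tgt C q) W \<and> l \<cdot> q = h" using assms(1) HomD(3) by metis
qed (use assms HomD in auto)

end

text \<open>The arguments M, N are ordered as in Ext^1(M, N), quotient before sub. Hiding the arrows
  lets each object be exchanged for an isomorphic one.\<close>

definition extends :: "('o, 'm) preadd_cat \<Rightarrow> 'o \<Rightarrow> 'o \<Rightarrow> 'o \<Rightarrow> bool" where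
  "extends C M N E \<longleftrightarrow> (\<exists>i\<in>Hom C N E. \<exists>p\<in>Hom C E M. short_exact C i p)"

text \<open>This is Ext^1(M, N) = 0, phrased with sections so that arguments can work with arrows
  instead of equivalence classes of extensions.\<close>

definition splitting_pair :: "('o, 'm) preadd_cat \<Rightarrow> 'o \<Rightarrow> 'o \<Rightarrow> bool" where
  "splitting_pair C M N \<longleftrightarrow>
     (\<forall>E. \<forall>i\<in>Hom C N E. \<forall>p\<in>Hom C E M. short_exact C i p \<longrightarrow>
        (\<exists>s\<in>Hom C M E. p \<cdot>\<^bsub>C\<^esub> s = ident C M))"

context abelian_category
begin

section \<open>Normal monomorphisms and short exact sequences\<close>

lemma cokernelE:
  assumes "f \<in> Hom C X Y"
  obtains q Q where "q \<in> Hom C Y Q" "is_cokernel C q f"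
  using cokernels[OF HomD(1)[OF assms]] is_cokernelE[OF _ assms] by metis

lemma kernelE:
  assumes "f \<in> Hom C X Y"
  obtains k K where "k \<in> Hom C K X" "is_kernel C k f"
  using kernels[OF HomD(1)[OF assms]] is_kernelE[OF _ assms] by metis

lemma is_cokernel_unique_iso:
  assumes "u \<in> Hom C X Y" "is_cokernel C q u" "q \<in> Hom C Y Q" "is_cokernel C q' u" "q' \<in> Hom C Y Q'"
  shows "isomorphic C Q Q'"
proof -
  have q: "q \<cdot> u = zero_ar C X Q" "is_epi C q"
    "\<And>W h. h \<in> Hom C Y W \<Longrightarrow> h \<cdot> u = zero_ar C X W \<Longrightarrow> \<exists>l\<in>Hom C Q W. l \<cdot> q = h"
    using is_cokernelE[OF assms(2,1)] HomD(3)[OF assms(3)] by metis+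
  have q': "q' \<cdot> u = zero_ar C X Q'" "is_epi C q'"
    "\<And>W h. h \<in> Hom C Y W \<Longrightarrow> h \<cdot> u = zero_ar C X W \<Longrightarrow> \<exists>l\<in>Hom C Q' W. l \<cdot> q' = h"
    using is_cokernelE[OF assms(4,1)] HomD(3)[OF assms(5)] by metis+
  obtain a where a: "a \<in> Hom C Q Q'" "a \<cdot> q = q'" using q(3) q'(1) assms(5) by metis
  obtain b where b: "b \<in> Hom C Q' Q" "b \<cdot> q' = q" using q'(3) q(1) assms(3) by metis
  have "(b \<cdot> a) \<cdot> q = ident C Q \<cdot> q" "(a \<cdot> b) \<cdot> q' = ident C Q' \<cdot> q'"
    using a b comp_assoc assms(3,5) ident_left by metis+
  then have "b \<cdot> a = ident C Q" "a \<cdot> b = ident C Q'"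
    using is_epiD[OF q(2) assms(3)] is_epiD[OF q'(2) assms(5)] a(1) b(1) comp_closed
      ident_closed[OF HomD(4)[OF a(1)]] ident_closed[OF HomD(4)[OF b(1)]] by blast+
  then show ?thesis unfolding isomorphic_def using is_isoI a(1) b(1) by blast
qed

text \<open>An epimorphism in front does not change which morphisms annihilate \<open>u\<close>. The
  case of interest is an isomorphism \<open>w\<close>, which changes the representative of a
  subobject.\<close>

lemma is_cokernel_comp_epi:
  assumes "is_cokernel C q u" "u \<in> Hom C X Y" "is_epi C w" "w \<in> Hom C W X"
  shows "is_cokernel C q (u \<cdot> w)"
proof -
  obtain Q where q: "q \<in> Hom C Y Q" "q \<cdot> u = zero_ar C X Q" "is_epi C q"
    "\<And>W h. h \<in> Hom C Y W \<Longrightarrow> h \<cdot> u = zero_ar C X W \<Longrightarrow> \<exists>l\<in>Hom C Q W. l \<cdot> q = h"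
    using is_cokernelE[OF assms(1,2)] by metis
  show ?thesis
  proof (rule is_cokernelI[OF q(1)])
    show "u \<cdot> w \<in> Hom C W Y" using comp_closed assms by blast
    show "q \<cdot> (u \<cdot> w) = zero_ar C W Q"
      using comp_assoc[OF assms(4,2) q(1)] q(2) comp_zero_left[OF assms(4) HomD(5)[OF q(1)]] by simp
    show "is_epi C q" by (rule q)
  next
    fix V h assume V: "V \<in> Ob C" and h: "h \<in> Hom C Y V" "h \<cdot> (u \<cdot> w) = zero_ar C W V"
    have "(h \<cdot> u) \<cdot> w = zero_ar C W V" using h comp_assoc assms by metis
    moreover have "h \<cdot> u \<in> Hom C X V" using h assms comp_closed by blast
    ultimately have "h \<cdot> u = zero_ar C X V" using is_epi_iff_zero assms V by blast
    then show "\<exists>l\<in>Hom C Q V. l \<cdot> q = h" using q(4) h by blast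
  qed
qed

lemma is_cokernel_iso_comp:
  assumes "is_cokernel C q u" "u \<in> Hom C X Y" "q \<in> Hom C Y Q" "is_iso C b" "b \<in> Hom C Q Q'"
  shows "is_cokernel C (b \<cdot> q) u"
proof -
  have q: "q \<cdot> u = zero_ar C X Q" "is_epi C q"
    "\<And>W h. h \<in> Hom C Y W \<Longrightarrow> h \<cdot> u = zero_ar C X W \<Longrightarrow> \<exists>l\<in>Hom C Q W. l \<cdot> q = h"
    using is_cokernelE[OF assms(1,2)] HomD(3)[OF assms(3)] by metis+
  obtain c where c: "c \<in> Hom C Q' Q" "c \<cdot> b = ident C Q" using is_isoE[OF assms(4,5)] by metis
  show ?thesis
  proof (rule is_cokernelI[OF comp_closed[OF assms(3,5)] assms(2)])
    show "(b \<cdot> q) \<cdot> u = zero_ar C X Q'"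
      using comp_assoc[OF assms(2,3,5)] q comp_zero_right[OF assms(5) HomD(4)[OF assms(2)]] by simp
    show "is_epi C (b \<cdot> q)" using comp_epi[OF q(2) assms(3)] iso_is_epi[OF assms(4,5)] assms(5) by blast
  next
    fix V h assume V: "V \<in> Ob C" and h: "h \<in> Hom C Y V" "h \<cdot> u = zero_ar C X V"
    then obtain l where l: "l \<in> Hom C Q V" "l \<cdot> q = h" using q by blast
    have "(l \<cdot> c) \<cdot> (b \<cdot> q) = l \<cdot> (c \<cdot> (b \<cdot> q))"
      using comp_assoc[OF comp_closed[OF assms(3,5)] c(1) l(1)] .
    also have "c \<cdot> (b \<cdot> q) = q" using comp_assoc[OF assms(3,5) c(1)] c ident_left assms(3) by simp
    finally show "\<exists>l\<in>Hom C Q' V. l \<cdot> (b \<cdot> q) = h" using l comp_closed[OF c(1) l(1)] by auto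
  qed
qed

text \<open>Normality gives only some \<open>f\<close> with kernel \<open>u\<close>. It factors
  through the cokernel \<open>q\<close>, so whatever \<open>q\<close> annihilates is annihilated by
  \<open>f\<close> and hence factors through \<open>u\<close>.\<close>

lemma mono_is_kernel_of_cokernel:
  assumes "is_mono C u" "u \<in> Hom C X Y" "is_cokernel C q u"
  shows "is_kernel C u q"
proof -
  obtain f where "is_kernel C u f" using mono_normal assms by blast
  moreover then obtain Z where f: "f \<in> Hom C Y Z"
    using HomI HomD(3)[OF assms(2)] unfolding is_kernel_def by metis
  ultimately have k: "f \<cdot> u = zero_ar C X Z"
    "\<And>W h. h \<in> Hom C W Y \<Longrightarrow> f \<cdot> h = zero_ar C W Z \<Longrightarrow> \<exists>l\<in>Hom C W X. u \<cdot> l = h"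
    using is_kernelE[OF _ f] HomD(2)[OF assms(2)] by metis+
  obtain Q where q: "q \<in> Hom C Y Q" "q \<cdot> u = zero_ar C X Q"
    "\<And>W h. h \<in> Hom C Y W \<Longrightarrow> h \<cdot> u = zero_ar C X W \<Longrightarrow> \<exists>l\<in>Hom C Q W. l \<cdot> q = h"
    using is_cokernelE[OF assms(3,2)] by metis
  obtain l where l: "l \<in> Hom C Q Z" "l \<cdot> q = f" using q(3) k(1) f by blast
  show ?thesis
  proof (rule is_kernelI[OF assms(2) q(1,2) assms(1)])
    fix W h assume W: "W \<in> Ob C" and h: "h \<in> Hom C W Y" "q \<cdot> h = zero_ar C W Q"
    have "f \<cdot> h = l \<cdot> (q \<cdot> h)" using comp_assoc[OF h(1) q(1) l(1)] l by simp
    also have "\<dots> = zero_ar C W Z" using h comp_zero_right[OF l(1) W] by simp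
    finally show "\<exists>l\<in>Hom C W X. u \<cdot> l = h" using k(2) h by blast
  qed
qed

lemma epi_is_cokernel_of_kernel:
  assumes "is_epi C q" "q \<in> Hom C Y Z" "is_kernel C k q"
  shows "is_cokernel C q k"
proof -
  obtain f where "is_cokernel C q f" using epi_normal assms by blast
  moreover then obtain X where f: "f \<in> Hom C X Y"
    using HomI HomD(2)[OF assms(2)] unfolding is_cokernel_def by metis
  ultimately have c: "q \<cdot> f = zero_ar C X Z"
    "\<And>W h. h \<in> Hom C Y W \<Longrightarrow> h \<cdot> f = zero_ar C X W \<Longrightarrow> \<exists>l\<in>Hom C Z W. l \<cdot> q = h"
    using is_cokernelE[OF _ f] HomD(3)[OF assms(2)] by metis+
  obtain K where k: "k \<in> Hom C K Y" "q \<cdot> k = zero_ar C K Z"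
    "\<And>W h. h \<in> Hom C W Y \<Longrightarrow> q \<cdot> h = zero_ar C W Z \<Longrightarrow> \<exists>l\<in>Hom C W K. k \<cdot> l = h"
    using is_kernelE[OF assms(3,2)] by metis
  obtain l where l: "l \<in> Hom C X K" "k \<cdot> l = f" using k(3) c(1) f by blast
  show ?thesis
  proof (rule is_cokernelI[OF assms(2) k(1,2) assms(1)])
    fix W h assume W: "W \<in> Ob C" and h: "h \<in> Hom C Y W" "h \<cdot> k = zero_ar C K W"
    have "h \<cdot> f = (h \<cdot> k) \<cdot> l" using comp_assoc[OF l(1) k(1) h(1)] l by simp
    also have "\<dots> = zero_ar C X W" using h comp_zero_left[OF l(1) W] by simp
    finally show "\<exists>l\<in>Hom C Z W. l \<cdot> q = h" using c(2) h by blast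
  qed
qed

lemma mono_short_exact:
  "\<lbrakk>is_mono C u; u \<in> Hom C X Y; is_cokernel C q u\<rbrakk> \<Longrightarrow> short_exact C u q"
  using mono_is_kernel_of_cokernel by (simp add: short_exact_def)

lemma epi_short_exact:
  "\<lbrakk>is_epi C q; q \<in> Hom C Y Z; is_kernel C k q\<rbrakk> \<Longrightarrow> short_exact C k q"
  using epi_is_cokernel_of_kernel by (simp add: short_exact_def)

lemma short_exactD:
  assumes "short_exact C i p" "i \<in> Hom C N E" "p \<in> Hom C E M"
  shows "is_mono C i" "is_epi C p" "p \<cdot> i = zero_ar C N M"
    "\<And>W h. h \<in> Hom C W E \<Longrightarrow> p \<cdot> h = zero_ar C W M \<Longrightarrow> \<exists>l\<in>Hom C W N. i \<cdot> l = h"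
    "\<And>W h. h \<in> Hom C E W \<Longrightarrow> h \<cdot> i = zero_ar C N W \<Longrightarrow> \<exists>l\<in>Hom C M W. l \<cdot> p = h"
proof -
  have "is_kernel C i p" "is_cokernel C p i" using assms by (auto simp: short_exact_def)
  then show "is_mono C i" "is_epi C p" "p \<cdot> i = zero_ar C N M"
    "\<And>W h. h \<in> Hom C W E \<Longrightarrow> p \<cdot> h = zero_ar C W M \<Longrightarrow> \<exists>l\<in>Hom C W N. i \<cdot> l = h"
    "\<And>W h. h \<in> Hom C E W \<Longrightarrow> h \<cdot> i = zero_ar C N W \<Longrightarrow> \<exists>l\<in>Hom C M W. l \<cdot> p = h"
    using is_kernelE[OF _ assms(3), of i] is_cokernelE[OF _ assms(2), of p]
      HomD(2)[OF assms(2)] HomD(3)[OF assms(3)] by metis+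
qed

lemma short_exact_Hom:
  assumes "short_exact C i p"
  shows "i \<in> Hom C (src C i) (tgt C i)" "p \<in> Hom C (tgt C i) (tgt C p)"
  using assms unfolding short_exact_def is_cokernel_def Hom_def by auto

section \<open>Extensions up to isomorphism and closed subcategories\<close>

lemma extendsD: "extends C M N E \<Longrightarrow> M \<in> Ob C \<and> N \<in> Ob C \<and> E \<in> Ob C"
  unfolding extends_def using HomD by blast

lemma extension_closedD:
  "extension_closed C S \<Longrightarrow> extends C M N E \<Longrightarrow> M \<in> S \<Longrightarrow> N \<in> S \<Longrightarrow> E \<in> S"
  unfolding extension_closed_def extends_def using HomD by metis

lemma extends_iso_middle:
  assumes "extends C M N E" "isomorphic C E E'"
  shows "extends C M N E'"
proof -
  obtain i p where ip: "i \<in> Hom C N E" "p \<in> Hom C E M" "short_exact C i p"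
    using assms unfolding extends_def by blast
  note se = short_exactD[OF ip(3,1,2)]
  obtain c where c: "c \<in> Hom C E E'" "is_iso C c" using assms unfolding isomorphic_def by blast
  obtain d where d: "d \<in> Hom C E' E" "d \<cdot> c = ident C E" "c \<cdot> d = ident C E'" "is_iso C d"
    using is_isoE c by metis
  have ci: "c \<cdot> i \<in> Hom C N E'" and pd: "p \<cdot> d \<in> Hom C E' M" using comp_closed c d ip by blast+
  have dci: "d \<cdot> (c \<cdot> i) = i" using comp_assoc[OF ip(1) c(1) d(1)] d ident_left ip(1) by simp
  have "is_cokernel C (p \<cdot> d) (c \<cdot> i)"
  proof (rule is_cokernelI[OF pd ci])
    show "(p \<cdot> d) \<cdot> (c \<cdot> i) = zero_ar C N M" using comp_assoc[OF ci d(1) ip(2)] dci se by simp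
    show "is_epi C (p \<cdot> d)" using comp_epi[OF iso_is_epi[OF d(4,1)] d(1) se(2) ip(2)] .
  next
    fix W h assume h: "h \<in> Hom C E' W" "h \<cdot> (c \<cdot> i) = zero_ar C N W"
    have hc: "h \<cdot> c \<in> Hom C E W" "(h \<cdot> c) \<cdot> i = zero_ar C N W"
      using h c comp_closed comp_assoc[OF ip(1) c(1) h(1)] by auto
    then obtain l where l: "l \<in> Hom C M W" "l \<cdot> p = h \<cdot> c" using se(5) by blast
    have "l \<cdot> (p \<cdot> d) = (h \<cdot> c) \<cdot> d" using comp_assoc[OF d(1) ip(2) l(1)] l by simp
    also have "\<dots> = h" using comp_assoc[OF d(1) c(1) h(1)] d ident_right h by simp
    finally show "\<exists>l\<in>Hom C M W. l \<cdot> (p \<cdot> d) = h" using l by blast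
  qed
  then show ?thesis unfolding extends_def
    using mono_short_exact[OF comp_mono[OF se(1) ip(1) iso_is_mono[OF c(2,1)] c(1)] ci] ci pd by blast
qed

lemma extends_iso_ends:
  assumes "extends C M N E" "isomorphic C M M'" "isomorphic C N N'"
  shows "extends C M' N' E"
proof -
  obtain i p where ip: "i \<in> Hom C N E" "p \<in> Hom C E M" "short_exact C i p"
    using assms unfolding extends_def by blast
  note se = short_exactD[OF ip(3,1,2)]
  obtain b where b: "b \<in> Hom C M M'" "is_iso C b" using assms unfolding isomorphic_def by blast
  obtain a where a: "a \<in> Hom C N' N" "is_iso C a"
    using isomorphic_sym[OF assms(3)] unfolding isomorphic_def by blast
  have ia: "i \<cdot> a \<in> Hom C N' E" and bp: "b \<cdot> p \<in> Hom C E M'" using comp_closed a b ip by blast+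
  have "is_cokernel C p (i \<cdot> a)"
    using is_cokernel_comp_epi[OF _ ip(1) iso_is_epi[OF a(2,1)] a(1)] ip(3) by (simp add: short_exact_def)
  then have "is_cokernel C (b \<cdot> p) (i \<cdot> a)" using is_cokernel_iso_comp[OF _ ia ip(2) b(2,1)] by blast
  moreover have "is_mono C (i \<cdot> a)" using comp_mono[OF iso_is_mono[OF a(2,1)] a(1) se(1) ip(1)] .
  ultimately show ?thesis unfolding extends_def using mono_short_exact ia bp by blast
qed

text \<open>The sequence 0 -> Z -> Y -> X -> 0 with an isomorphism on the right. Through it, closure
  under extensions forces closure under isomorphism.\<close>

lemma extends_zero:
  assumes "is_zero_object C Z" "isomorphic C X Y"
  shows "extends C X Z Y"
proof -
  obtain f where f: "f \<in> Hom C Y X" "is_iso C f"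
    using isomorphic_sym[OF assms(2)] unfolding isomorphic_def by blast
  obtain g where g: "g \<in> Hom C X Y" "g \<cdot> f = ident C Y" using is_isoE f by metis
  have Ob: "Z \<in> Ob C" "X \<in> Ob C" "Y \<in> Ob C"
    using assms(1) HomD(4,5)[OF f(1)] unfolding is_zero_object_def by blast+
  have z: "zero_ar C Z Y \<in> Hom C Z Y" using Ob zero_closed by blast
  have to_Z: "h = h'" if "h \<in> Hom C W Z" "h' \<in> Hom C W Z" for h h' W
    using assms(1) that HomD(4)[OF that(1)] unfolding is_zero_object_def by blast
  have from_Z: "h = h'" if "h \<in> Hom C Z W" "h' \<in> Hom C Z W" for h h' W
    using assms(1) that HomD(5)[OF that(1)] unfolding is_zero_object_def by blast
  have "is_mono C (zero_ar C Z Y)" unfolding is_mono_iff_zero[OF z]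
    using to_Z zero_closed Ob by blast
  moreover have "is_cokernel C f (zero_ar C Z Y)"
  proof (rule is_cokernelI[OF f(1) z])
    show "f \<cdot> zero_ar C Z Y = zero_ar C Z X" by (rule comp_zero_right[OF f(1) Ob(1)])
    show "is_epi C f" using iso_is_epi f by blast
  next
    fix W h assume h: "h \<in> Hom C Y W"
    have "(h \<cdot> g) \<cdot> f = h" using comp_assoc[OF f(1) g(1) h] g ident_right h by simp
    then show "\<exists>l\<in>Hom C X W. l \<cdot> f = h" using comp_closed[OF g(1) h] by blast
  qed
  ultimately show ?thesis unfolding extends_def using mono_short_exact z f(1) by blast
qed

text \<open>An invariant of the induction on factorizing sequences: it makes
  \<open>iso_class C X \<in> Iso C B\<close> equivalent to \<open>X \<in> B\<close>, so that
  extension closure can exclude classes outside \<open>Iso C B\<close>.\<close>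

definition iso_closed :: "'a set \<Rightarrow> bool" where
  "iso_closed S \<longleftrightarrow> (\<forall>X\<in>S. \<forall>Y. isomorphic C X Y \<longrightarrow> Y \<in> S)"

lemma extension_closed_iso_closed:
  assumes "extension_closed C S" "Z \<in> S" "is_zero_object C Z"
  shows "iso_closed S"
  unfolding iso_closed_def using extension_closedD[OF assms(1) extends_zero[OF assms(3)]] assms(2) by blast

lemma iso_closed_Ob: "iso_closed (Ob C)"
  unfolding iso_closed_def isomorphic_def using HomD(5) by blast

lemma extension_closed_Ob: "extension_closed C (Ob C)"
  unfolding extension_closed_def using short_exact_Hom HomD(5) by blast

text \<open>Each competing \<open>T\<close> has a zero object and so is closed under isomorphism.
  Both closure properties survive intersection, but the intersection is formed inside
  \<open>B\<close>, hence the hypotheses on \<open>B\<close>.\<close>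

lemma generated_subcategory_closed:
  assumes "extension_closed C B" "iso_closed B"
  shows "extension_closed C (generated_subcategory C B Ss)" "iso_closed (generated_subcategory C B Ss)"
proof -
  have "iso_closed T" if "additive_subcategory C T" "extension_closed C T" for T
    using that extension_closed_iso_closed unfolding additive_subcategory_def by blast
  then show "iso_closed (generated_subcategory C B Ss)"
    using assms(2) unfolding iso_closed_def generated_subcategory_def by blast
  show "extension_closed C (generated_subcategory C B Ss)"
    using assms(1) unfolding extension_closed_def generated_subcategory_def by blast
qed

section \<open>Subobjects and the classes of their objects and quotients\<close>

lemma subobject_class:
  assumes "is_mono C u" "u \<in> Hom C A X"
  shows "v \<in> subobject_equiv C X `` {u} \<longleftrightarrow>
    is_mono C v \<and> tgt C v = X \<and> (\<exists>w\<in>Hom C A (src C v). is_iso C w \<and> v \<cdot> w = u)"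
  using assms HomD(2,3)[OF assms(2)] unfolding subobject_equiv_def by auto

text \<open>An isomorphism from \<open>Y\<close> to \<open>A\<close> followed by \<open>u\<close>
  represents the same subobject, so the sources of the representatives exhaust the isomorphism
  class.\<close>

lemma sub_objects_class:
  assumes "is_mono C u" "u \<in> Hom C A X"
  shows "sub_objects C (subobject_equiv C X `` {u}) = iso_class C A"
proof (intro equalityI subsetI)
  fix Y assume "Y \<in> sub_objects C (subobject_equiv C X `` {u})"
  then show "Y \<in> iso_class C A"
    unfolding sub_objects_def iso_class_def isomorphic_def
    using subobject_class[OF assms] HomD(5) by blast
next
  fix Y assume "Y \<in> iso_class C A"
  then obtain w where w: "w \<in> Hom C A Y" "is_iso C w" unfolding iso_class_def isomorphic_def by blast
  then obtain v where v: "v \<in> Hom C Y A" "v \<cdot> w = ident C A" "is_iso C v" using is_isoE by metis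
  have uv: "u \<cdot> v \<in> Hom C Y X" "is_mono C (u \<cdot> v)"
    using comp_closed comp_mono iso_is_mono v assms by blast+
  have "(u \<cdot> v) \<cdot> w = u" using comp_assoc[OF w(1) v(1) assms(2)] v ident_right assms(2) by simp
  then have "u \<cdot> v \<in> subobject_equiv C X `` {u}"
    unfolding subobject_class[OF assms] using uv w HomD(2,3)[OF uv(1)] by blast
  then show "Y \<in> sub_objects C (subobject_equiv C X `` {u})"
    unfolding sub_objects_def using HomD(2)[OF uv(1)] by force
qed

text \<open>A cokernel of any representative is also a cokernel of \<open>u\<close>, hence has
  isomorphic target; conversely \<open>q\<close> followed by an isomorphism is a cokernel whose
  target is any prescribed member of the class.\<close>

lemma quot_objects_class:
  assumes "is_mono C u" "u \<in> Hom C A X" "is_cokernel C q u" "q \<in> Hom C X Q"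
  shows "quot_objects C (subobject_equiv C X `` {u}) = iso_class C Q"
proof (intro equalityI subsetI)
  fix Y assume "Y \<in> quot_objects C (subobject_equiv C X `` {u})"
  then obtain v q' w where v: "is_mono C v" "tgt C v = X" and w: "w \<in> Hom C A (src C v)" "is_iso C w"
    "v \<cdot> w = u" and q': "is_cokernel C q' v" "Y = tgt C q'"
    unfolding quot_objects_def using subobject_class[OF assms(1,2)] by blast
  have vH: "v \<in> Hom C (src C v) X" using v HomI unfolding is_mono_def by blast
  obtain "q' \<in> Hom C X Y" using is_cokernelE[OF q'(1) vH] q'(2) by metis
  moreover have "is_cokernel C q' u"
    using is_cokernel_comp_epi[OF q'(1) vH iso_is_epi[OF w(2,1)] w(1)] w(3) by simp
  ultimately show "Y \<in> iso_class C Q"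
    unfolding iso_class_def using is_cokernel_unique_iso[OF assms(2,3,4)] HomD(5) by blast
next
  fix Y assume "Y \<in> iso_class C Q"
  then obtain b where b: "b \<in> Hom C Q Y" "is_iso C b" unfolding iso_class_def isomorphic_def by blast
  have "is_cokernel C (b \<cdot> q) u" using is_cokernel_iso_comp[OF assms(3,2,4) b(2,1)] .
  moreover have "tgt C (b \<cdot> q) = Y" using HomD(3) comp_closed assms(4) b(1) by blast
  moreover have "u \<in> subobject_equiv C X `` {u}"
    unfolding subobject_class[OF assms(1,2)]
    using assms(1) HomD[OF assms(2)] ident_closed ident_iso ident_right[OF assms(2)] by blast
  ultimately show "Y \<in> quot_objects C (subobject_equiv C X `` {u})"
    unfolding quot_objects_def by blast
qed

text \<open>With the converse \<open>extends_subobject\<close>, this trades a subobject for an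
  extension whose two ends carry its classes.\<close>

lemma subobject_extends:
  assumes "U \<in> subobjects C X"
  obtains A Q where "sub_objects C U = iso_class C A" "quot_objects C U = iso_class C Q" "extends C Q A X"
proof -
  obtain u where u: "is_mono C u" "tgt C u = X" "U = subobject_equiv C X `` {u}"
    using assms unfolding subobjects_def quotient_def by blast
  define A where "A = src C u"
  have uH: "u \<in> Hom C A X" using u HomI unfolding A_def is_mono_def by blast
  obtain q Q where q: "q \<in> Hom C X Q" "is_cokernel C q u" using cokernelE[OF uH] by metis
  have "extends C Q A X" unfolding extends_def using mono_short_exact[OF u(1) uH q(2)] q(1) uH by blast
  then show ?thesis
    using that sub_objects_class[OF u(1) uH] quot_objects_class[OF u(1) uH q(2,1)] u(3) by blast
qed

lemma extends_subobject:
  assumes "extends C Q A X"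
  shows "\<exists>U\<in>subobjects C X. sub_objects C U = iso_class C A \<and> quot_objects C U = iso_class C Q"
proof -
  obtain u q where u: "u \<in> Hom C A X" and q: "q \<in> Hom C X Q" "short_exact C u q"
    using assms unfolding extends_def by blast
  have m: "is_mono C u" "is_cokernel C q u" using short_exactD[OF q(2) u q(1)] q(2)
    by (auto simp: short_exact_def)
  have "subobject_equiv C X `` {u} \<in> subobjects C X"
    unfolding subobjects_def quotient_def using m(1) HomD(3)[OF u] by blast
  then show ?thesis using sub_objects_class[OF m(1) u] quot_objects_class[OF m(1) u m(2) q(1)] by blast
qed

section \<open>Split short exact sequences and biproducts\<close>

lemma short_exact_section:
  assumes "short_exact C i p" "i \<in> Hom C N E" "p \<in> Hom C E M" "s \<in> Hom C M E" "p \<cdot> s = ident C M"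
  obtains r where "r \<in> Hom C E N" "r \<cdot> i = ident C N" "r \<cdot> s = zero_ar C M N"
    "add_ar C (i \<cdot> r) (s \<cdot> p) = ident C E"
proof -
  note se = short_exactD[OF assms(1,2,3)]
  have Ob: "N \<in> Ob C" "E \<in> Ob C" "M \<in> Ob C"
    using HomD(4)[OF assms(2)] HomD(4,5)[OF assms(3)] by blast+
  note id = ident_closed[OF Ob(1)] ident_closed[OF Ob(2)] ident_closed[OF Ob(3)]
  have sp: "s \<cdot> p \<in> Hom C E E" using comp_closed assms by blast
  \<comment> \<open>\<open>d\<close> is 1 - s p. It is annihilated by \<open>p\<close>, so it
    factors through the kernel \<open>i\<close>, and the factor is the retraction
    \<open>r\<close>.\<close>
  obtain d where d: "d \<in> Hom C E E" "add_ar C d (s \<cdot> p) = ident C E"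
    using ex_difference[OF id(2) sp] by blast
  have psp: "p \<cdot> (s \<cdot> p) = p" using comp_assoc[OF assms(3,4,3)] assms(5) ident_left assms(3) by simp
  have sps: "(s \<cdot> p) \<cdot> s = s" using comp_assoc[OF assms(4,3,4)] assms(5) ident_right assms(4) by simp
  have spi: "(s \<cdot> p) \<cdot> i = zero_ar C N E"
    using comp_assoc[OF assms(2,3,4)] se(3) comp_zero_right[OF assms(4) Ob(1)] by simp
  have pd: "p \<cdot> d \<in> Hom C E M" and di: "d \<cdot> i \<in> Hom C N E" and ds: "d \<cdot> s \<in> Hom C M E"
    using comp_closed assms d by blast+
  have "add_ar C (p \<cdot> d) p = add_ar C (zero_ar C E M) p"
    using comp_add_right[OF d(1) sp assms(3)] d(2) ident_right[OF assms(3)] psp add_zero[OF assms(3)] by simp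
  then have "p \<cdot> d = zero_ar C E M" using add_cancel_right pd zero_closed Ob assms(3) by blast
  then obtain r where r: "r \<in> Hom C E N" "i \<cdot> r = d" using se(4)[OF d(1)] by blast
  have dii: "d \<cdot> i = i"
    using comp_add_left[OF assms(2) d(1) sp] d(2) ident_left[OF assms(2)] spi add_zero[OF di] by simp
  have "i \<cdot> (r \<cdot> i) = i \<cdot> ident C N"
    using dii comp_assoc[OF assms(2) r(1) assms(2)] r(2) ident_right[OF assms(2)] by simp
  then have ri: "r \<cdot> i = ident C N" using is_monoD[OF se(1) assms(2)] comp_closed r assms(2) id by blast
  have "add_ar C (d \<cdot> s) s = add_ar C (zero_ar C M E) s"
    using comp_add_left[OF assms(4) d(1) sp] d(2) ident_left[OF assms(4)] sps add_zero[OF assms(4)] by simp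
  then have "d \<cdot> s = zero_ar C M E" using add_cancel_right ds zero_closed Ob assms(4) by blast
  then have "i \<cdot> (r \<cdot> s) = zero_ar C M E" using comp_assoc[OF assms(4) r(1) assms(2)] r(2) by simp
  then have "r \<cdot> s = zero_ar C M N"
    using se(1) comp_closed[OF assms(4) r(1)] Ob unfolding is_mono_iff_zero[OF assms(2)] by blast
  then show ?thesis using that r ri d(2) by blast
qed

text \<open>Dually, 1 - i r annihilates \<open>i\<close> and factors through the cokernel
  \<open>p\<close>. The point is that a retraction pulls back along a morphism of middle terms,
  where a section would have to be lifted.\<close>

lemma short_exact_retraction:
  assumes "short_exact C i p" "i \<in> Hom C N E" "p \<in> Hom C E M" "r \<in> Hom C E N" "r \<cdot> i = ident C N"
  shows "\<exists>s\<in>Hom C M E. p \<cdot> s = ident C M"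
proof -
  note se = short_exactD[OF assms(1,2,3)]
  have Ob: "N \<in> Ob C" "E \<in> Ob C" "M \<in> Ob C"
    using HomD(4)[OF assms(2)] HomD(4,5)[OF assms(3)] by blast+
  note id = ident_closed[OF Ob(1)] ident_closed[OF Ob(2)] ident_closed[OF Ob(3)]
  have ir: "i \<cdot> r \<in> Hom C E E" using comp_closed assms by blast
  obtain d where d: "d \<in> Hom C E E" "add_ar C d (i \<cdot> r) = ident C E"
    using ex_difference[OF id(2) ir] by blast
  have iri: "(i \<cdot> r) \<cdot> i = i" using comp_assoc[OF assms(2,4,2)] assms(5) ident_right assms(2) by simp
  have pir: "p \<cdot> (i \<cdot> r) = zero_ar C E M"
    using comp_assoc[OF assms(4,2,3)] se(3) comp_zero_left[OF assms(4) Ob(3)] by simp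
  have pd: "p \<cdot> d \<in> Hom C E M" and di: "d \<cdot> i \<in> Hom C N E" using comp_closed assms d by blast+
  have "add_ar C (d \<cdot> i) i = add_ar C (zero_ar C N E) i"
    using comp_add_left[OF assms(2) d(1) ir] d(2) ident_left[OF assms(2)] iri add_zero[OF assms(2)] by simp
  then have "d \<cdot> i = zero_ar C N E" using add_cancel_right di zero_closed Ob assms(2) by blast
  then obtain s where s: "s \<in> Hom C M E" "s \<cdot> p = d" using se(5)[OF d(1)] by blast
  have "p \<cdot> d = p"
    using comp_add_right[OF d(1) ir assms(3)] d(2) ident_right[OF assms(3)] pir add_zero[OF pd] by simp
  then have "(p \<cdot> s) \<cdot> p = ident C M \<cdot> p"
    using comp_assoc[OF assms(3) s(1) assms(3)] s(2) ident_left[OF assms(3)] by simp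
  then have "p \<cdot> s = ident C M" using is_epiD[OF se(2) assms(3)] comp_closed s assms(3) id by blast
  then show ?thesis using s by blast
qed

text \<open>Once split, the middle term is determined up to isomorphism by its ends; this gives
  surjectivity in \<open>factorizing_pair_bij\<close>.\<close>

lemma extends_splitting_pair_biproduct:
  assumes "splitting_pair C M N" "extends C M N E"
  shows "is_biproduct C N M E"
proof -
  obtain i p where ip: "i \<in> Hom C N E" "p \<in> Hom C E M" "short_exact C i p"
    using assms unfolding extends_def by blast
  obtain s where s: "s \<in> Hom C M E" "p \<cdot> s = ident C M"
    using assms(1) ip unfolding splitting_pair_def by blast
  show ?thesis unfolding is_biproduct_def
    using short_exact_section[OF ip(3,1,2) s] ip s short_exactD(3)[OF ip(3,1,2)] by metis
qed

text \<open>Since h = (h i) p + (h j) q, a morphism that annihilates \<open>i\<close> factors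
  through the projection \<open>q\<close>. This supplies an object with prescribed sub and
  quotient.\<close>

lemma biproduct_extends:
  assumes "is_biproduct C N M P"
  shows "extends C M N P"
proof -
  obtain i j p q where H: "i \<in> Hom C N P" "j \<in> Hom C M P" "p \<in> Hom C P N" "q \<in> Hom C P M"
    and e: "p \<cdot> i = ident C N" "q \<cdot> j = ident C M" "q \<cdot> i = zero_ar C N M" "p \<cdot> j = zero_ar C M N"
      "add_ar C (i \<cdot> p) (j \<cdot> q) = ident C P"
    using assms unfolding is_biproduct_def by blast
  have "is_mono C i" unfolding is_mono_iff_zero[OF H(1)]
  proof (intro ballI impI)
    fix W h assume W: "W \<in> Ob C" and h: "h \<in> Hom C W N" "i \<cdot> h = zero_ar C W P"
    have "h = p \<cdot> (i \<cdot> h)" using comp_assoc[OF h(1) H(1,3)] e ident_left h by simp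
    then show "h = zero_ar C W N" using h(2) comp_zero_right[OF H(3) W] by simp
  qed
  moreover have "is_cokernel C q i"
  proof (rule is_cokernelI[OF H(4,1) e(3)])
    show "is_epi C q" unfolding is_epi_iff_zero[OF H(4)]
    proof (intro ballI impI)
      fix W h assume W: "W \<in> Ob C" and h: "h \<in> Hom C M W" "h \<cdot> q = zero_ar C P W"
      have "h = (h \<cdot> q) \<cdot> j" using comp_assoc[OF H(2,4) h(1)] e ident_right h by simp
      then show "h = zero_ar C M W" using h(2) comp_zero_left[OF H(2) W] by simp
    qed
  next
    fix W h assume W: "W \<in> Ob C" and h: "h \<in> Hom C P W" "h \<cdot> i = zero_ar C N W"
    have ip: "i \<cdot> p \<in> Hom C P P" "j \<cdot> q \<in> Hom C P P" using comp_closed H by blast+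
    have hjq: "(h \<cdot> j) \<cdot> q \<in> Hom C P W" "h \<cdot> j \<in> Hom C M W" using comp_closed H h by blast+
    have "h = add_ar C (h \<cdot> (i \<cdot> p)) (h \<cdot> (j \<cdot> q))"
      using comp_add_right[OF ip h(1)] e(5) ident_right[OF h(1)] by simp
    also have "h \<cdot> (i \<cdot> p) = zero_ar C P W"
      using comp_assoc[OF H(3,1) h(1)] h(2) comp_zero_left[OF H(3) W] by simp
    also have "h \<cdot> (j \<cdot> q) = (h \<cdot> j) \<cdot> q" using comp_assoc[OF H(4,2) h(1)] by simp
    finally have "h = (h \<cdot> j) \<cdot> q" using add_zero[OF hjq(1)] by simp
    then show "\<exists>l\<in>Hom C M W. l \<cdot> q = h" using hjq by metis
  qed
  ultimately show ?thesis unfolding extends_def using mono_short_exact H by blast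
qed

text \<open>The coproduct half of the universal property: a p + b q has the required restrictions,
  and a morphism is recovered from its own restrictions as (f i) p + (f j) q.\<close>

lemma biproduct_universal:
  assumes "is_biproduct C X Y P"
  obtains i j where "i \<in> Hom C X P" "j \<in> Hom C Y P"
    "\<And>W a b. a \<in> Hom C X W \<Longrightarrow> b \<in> Hom C Y W \<Longrightarrow> \<exists>f\<in>Hom C P W. f \<cdot> i = a \<and> f \<cdot> j = b"
    "\<And>W f g. f \<in> Hom C P W \<Longrightarrow> g \<in> Hom C P W \<Longrightarrow> f \<cdot> i = g \<cdot> i \<Longrightarrow> f \<cdot> j = g \<cdot> j \<Longrightarrow> f = g"
proof -
  obtain i j p q where H: "i \<in> Hom C X P" "j \<in> Hom C Y P" "p \<in> Hom C P X" "q \<in> Hom C P Y"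
    and e: "p \<cdot> i = ident C X" "q \<cdot> j = ident C Y" "q \<cdot> i = zero_ar C X Y" "p \<cdot> j = zero_ar C Y X"
      "add_ar C (i \<cdot> p) (j \<cdot> q) = ident C P"
    using assms unfolding is_biproduct_def by blast
  have ip: "i \<cdot> p \<in> Hom C P P" "j \<cdot> q \<in> Hom C P P" using comp_closed H by blast+
  show ?thesis
  proof (rule that[OF H(1,2)])
    fix W a b assume a: "a \<in> Hom C X W" and b: "b \<in> Hom C Y W"
    have ap: "a \<cdot> p \<in> Hom C P W" and bq: "b \<cdot> q \<in> Hom C P W" using comp_closed H a b by blast+
    let ?f = "add_ar C (a \<cdot> p) (b \<cdot> q)"
    have "(a \<cdot> p) \<cdot> i = a" "(b \<cdot> q) \<cdot> i = zero_ar C X W"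
      using comp_assoc[OF H(1,3) a] comp_assoc[OF H(1,4) b] e ident_right[OF a]
        comp_zero_right[OF b HomD(4)[OF H(1)]] by simp_all
    then have 1: "?f \<cdot> i = a" using comp_add_left[OF H(1) ap bq] add_zero[OF a] by simp
    have "(a \<cdot> p) \<cdot> j = zero_ar C Y W" "(b \<cdot> q) \<cdot> j = b"
      using comp_assoc[OF H(2,3) a] comp_assoc[OF H(2,4) b] e ident_right[OF b]
        comp_zero_right[OF a HomD(4)[OF H(2)]] by simp_all
    then have 2: "?f \<cdot> j = b" using comp_add_left[OF H(2) ap bq] add_zero[OF b] by simp
    show "\<exists>f\<in>Hom C P W. f \<cdot> i = a \<and> f \<cdot> j = b" using 1 2 add_closed[OF ap bq] by blast
  next
    fix W f g assume f: "f \<in> Hom C P W" and g: "g \<in> Hom C P W"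
      and eq: "f \<cdot> i = g \<cdot> i" "f \<cdot> j = g \<cdot> j"
    have "h = add_ar C ((h \<cdot> i) \<cdot> p) ((h \<cdot> j) \<cdot> q)" if h: "h \<in> Hom C P W" for h
      using comp_add_right[OF ip h] e(5) ident_right[OF h] comp_assoc[OF H(3,1) h]
        comp_assoc[OF H(4,2) h] by simp
    from this[OF f] this[OF g] show "f = g" using eq by simp
  qed
qed

lemma biproduct_unique_iso:
  assumes "is_biproduct C X Y P" "is_biproduct C X Y P'"
  shows "isomorphic C P P'"
proof -
  obtain i j where i: "i \<in> Hom C X P" and j: "j \<in> Hom C Y P"
    and ex: "\<And>W a b. a \<in> Hom C X W \<Longrightarrow> b \<in> Hom C Y W \<Longrightarrow> \<exists>f\<in>Hom C P W. f \<cdot> i = a \<and> f \<cdot> j = b"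
    and un: "\<And>W f g. f \<in> Hom C P W \<Longrightarrow> g \<in> Hom C P W \<Longrightarrow> f \<cdot> i = g \<cdot> i \<Longrightarrow> f \<cdot> j = g \<cdot> j \<Longrightarrow> f = g"
    using biproduct_universal[OF assms(1)] by metis
  obtain i' j' where i': "i' \<in> Hom C X P'" and j': "j' \<in> Hom C Y P'"
    and ex': "\<And>W a b. a \<in> Hom C X W \<Longrightarrow> b \<in> Hom C Y W \<Longrightarrow> \<exists>f\<in>Hom C P' W. f \<cdot> i' = a \<and> f \<cdot> j' = b"
    and un': "\<And>W f g. f \<in> Hom C P' W \<Longrightarrow> g \<in> Hom C P' W \<Longrightarrow> f \<cdot> i' = g \<cdot> i' \<Longrightarrow> f \<cdot> j' = g \<cdot> j' \<Longrightarrow> f = g"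
    using biproduct_universal[OF assms(2)] by metis
  obtain f where f: "f \<in> Hom C P P'" "f \<cdot> i = i'" "f \<cdot> j = j'" using ex[OF i' j'] by blast
  obtain g where g: "g \<in> Hom C P' P" "g \<cdot> i' = i" "g \<cdot> j' = j" using ex'[OF i j] by blast
  have gf: "g \<cdot> f \<in> Hom C P P" "f \<cdot> g \<in> Hom C P' P'" using comp_closed f g by blast+
  have id: "ident C P \<in> Hom C P P" "ident C P' \<in> Hom C P' P'"
    using ident_closed HomD(4)[OF f(1)] HomD(4)[OF g(1)] by blast+
  have "g \<cdot> f = ident C P"
    by (rule un[OF gf(1) id(1)])
      (simp_all add: comp_assoc[OF i f(1) g(1)] comp_assoc[OF j f(1) g(1)] f g ident_left[OF i] ident_left[OF j])
  moreover have "f \<cdot> g = ident C P'"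
    by (rule un'[OF gf(2) id(2)])
      (simp_all add: comp_assoc[OF i' g(1) f(1)] comp_assoc[OF j' g(1) f(1)] f g ident_left[OF i'] ident_left[OF j'])
  ultimately show ?thesis unfolding isomorphic_def using is_isoI f(1) g(1) by blast
qed

text \<open>Exactness of Ext^1(M', N) -> Ext^1(M, N) -> Ext^1(M'', N) in the middle. Restricting the
  extension E of M by N to M'' gives a split sequence, which embeds M'' in E. The quotient E/M'' is
  an extension of M' by N, and a retraction of it onto N composes with E -> E/M'' to a retraction of
  \<open>i\<close>.\<close>

lemma splitting_pair_extension:
  assumes "splitting_pair C M'' N" "splitting_pair C M' N" "extends C M' M'' M"
  shows "splitting_pair C M N"
  unfolding splitting_pair_def
proof (intro allI ballI impI)
  fix E i p assume i: "i \<in> Hom C N E" and p: "p \<in> Hom C E M" and ip: "short_exact C i p"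
  obtain u q where u: "u \<in> Hom C M'' M" and q: "q \<in> Hom C M M'" and uq: "short_exact C u q"
    using assms(3) unfolding extends_def by blast
  note P = short_exactD[OF ip i p] and Q = short_exactD[OF uq u q]
  have Ob: "N \<in> Ob C" "E \<in> Ob C" "M \<in> Ob C" "M' \<in> Ob C" "M'' \<in> Ob C"
    using HomD(4)[OF i] HomD(4,5)[OF p] HomD(5)[OF q] HomD(4)[OF u] by blast+
  have qp: "q \<cdot> p \<in> Hom C E M'" using comp_closed p q by blast
  have qpe: "is_epi C (q \<cdot> p)" using comp_epi P(2) p Q(2) q by blast
  \<comment> \<open>\<open>L\<close> is the preimage of \<open>M''\<close> in \<open>E\<close>. A section over \<open>M''\<close> makes \<open>E' = E/M''\<close> an extension of \<open>M'\<close> by \<open>N\<close>.\<close>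
  obtain k L where k: "k \<in> Hom C L E" "is_kernel C k (q \<cdot> p)" using kernelE[OF qp] by metis
  note K = short_exactD[OF epi_short_exact[OF qpe qp k(2)] k(1) qp]
  have L: "L \<in> Ob C" using HomD(4)[OF k(1)] .
  have "(q \<cdot> p) \<cdot> i = zero_ar C N M'"
    using comp_assoc[OF i p q] P(3) comp_zero_right[OF q Ob(1)] by simp
  then obtain i' where i': "i' \<in> Hom C N L" "k \<cdot> i' = i" using K(4)[OF i] by blast
  have pk: "p \<cdot> k \<in> Hom C L M" using comp_closed k p by blast
  have "q \<cdot> (p \<cdot> k) = zero_ar C L M'" using comp_assoc[OF k(1) p q] K(3) by simp
  then obtain p' where p': "p' \<in> Hom C L M''" "u \<cdot> p' = p \<cdot> k" using Q(4)[OF pk] by blast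
  have i'm: "is_mono C i'" unfolding is_mono_iff_zero[OF i'(1)]
  proof (intro ballI impI)
    fix W h assume W: "W \<in> Ob C" and h: "h \<in> Hom C W N" "i' \<cdot> h = zero_ar C W L"
    have "i \<cdot> h = zero_ar C W E"
      using comp_assoc[OF h(1) i'(1) k(1)] h(2) i'(2) comp_zero_right[OF k(1) W] by simp
    then show "h = zero_ar C W N" using P(1) h(1) W unfolding is_mono_iff_zero[OF i] by blast
  qed
  have "is_kernel C i' p'"
  proof (rule is_kernelI[OF i'(1) p'(1) _ i'm])
    have p'i': "p' \<cdot> i' \<in> Hom C N M''" using comp_closed i' p' by blast
    have "u \<cdot> (p' \<cdot> i') = zero_ar C N M"
      using comp_assoc[OF i'(1) p'(1) u] comp_assoc[OF i'(1) k(1) p] p'(2) i'(2) P(3) by simp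
    then show "p' \<cdot> i' = zero_ar C N M''"
      using Q(1) p'i' Ob unfolding is_mono_iff_zero[OF u] by blast
  next
    fix W h assume W: "W \<in> Ob C" and h: "h \<in> Hom C W L" "p' \<cdot> h = zero_ar C W M''"
    have kh: "k \<cdot> h \<in> Hom C W E" using comp_closed h k by blast
    have "p \<cdot> (k \<cdot> h) = u \<cdot> (p' \<cdot> h)"
      using comp_assoc[OF h(1) k(1) p] comp_assoc[OF h(1) p'(1) u] p'(2) by simp
    then have "p \<cdot> (k \<cdot> h) = zero_ar C W M" using h(2) comp_zero_right[OF u W] by simp
    then obtain l where l: "l \<in> Hom C W N" "i \<cdot> l = k \<cdot> h" using P(4)[OF kh] by blast
    have "k \<cdot> (i' \<cdot> l) = k \<cdot> h" using comp_assoc[OF l(1) i'(1) k(1)] i'(2) l(2) by simp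
    then have "i' \<cdot> l = h" using is_monoD[OF K(1) k(1)] comp_closed[OF l(1) i'(1)] h(1) by blast
    then show "\<exists>l\<in>Hom C W N. i' \<cdot> l = h" using l by blast
  qed
  \<comment> \<open>An instance of stability of epimorphisms under pullback. \<open>J\<close> is the
    image of \<open>p'\<close>, obtained as the kernel of its cokernel \<open>f\<close>, and
    \<open>c\<close> is the quotient of \<open>M\<close> by \<open>J\<close>. Then c p annihilates
    \<open>k\<close>, which makes \<open>c\<close> factor through \<open>q\<close>.\<close>
  moreover have p'e: "is_epi C p'"
  proof -
    obtain f F where f: "f \<in> Hom C M'' F" "is_cokernel C f p'" using cokernelE[OF p'(1)] by metis
    have fp': "f \<cdot> p' = zero_ar C L F" "\<And>W h. h \<in> Hom C M'' W \<Longrightarrow> h \<cdot> p' = zero_ar C L W \<Longrightarrow> \<exists>l\<in>Hom C F W. l \<cdot> f = h"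
      using is_cokernelE[OF f(2) p'(1)] HomD(3)[OF f(1)] by metis+
    have F: "F \<in> Ob C" using HomD(5)[OF f(1)] .
    obtain j J where j: "j \<in> Hom C J M''" "is_kernel C j f" using kernelE[OF f(1)] by metis
    have J: "f \<cdot> j = zero_ar C J F" "is_mono C j"
      "\<And>W h. h \<in> Hom C W M'' \<Longrightarrow> f \<cdot> h = zero_ar C W F \<Longrightarrow> \<exists>l\<in>Hom C W J. j \<cdot> l = h"
      using is_kernelE[OF j(2) f(1)] HomD(2)[OF j(1)] by metis+
    have ObJ: "J \<in> Ob C" using HomD(4)[OF j(1)] .
    obtain p'' where p'': "p'' \<in> Hom C L J" "j \<cdot> p'' = p'" using J(3)[OF p'(1) fp'(1)] by blast
    have uj: "u \<cdot> j \<in> Hom C J M" "is_mono C (u \<cdot> j)"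
      using comp_closed[OF j(1) u] comp_mono[OF J(2) j(1) Q(1) u] by blast+
    obtain c D where c: "c \<in> Hom C M D" "is_cokernel C c (u \<cdot> j)" using cokernelE[OF uj(1)] by metis
    note CJ = short_exactD[OF mono_short_exact[OF uj(2,1) c(2)] uj(1) c(1)]
    have D: "D \<in> Ob C" using HomD(5)[OF c(1)] .
    have cp: "c \<cdot> p \<in> Hom C E D" using comp_closed p c by blast
    have "(c \<cdot> p) \<cdot> k = c \<cdot> (u \<cdot> p')" using comp_assoc[OF k(1) p c(1)] p'(2) by simp
    also have "u \<cdot> p' = (u \<cdot> j) \<cdot> p''" using comp_assoc[OF p''(1) j(1) u] p''(2) by simp
    also have "c \<cdot> ((u \<cdot> j) \<cdot> p'') = (c \<cdot> (u \<cdot> j)) \<cdot> p''" using comp_assoc[OF p''(1) uj(1) c(1)] by simp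
    also have "\<dots> = zero_ar C L D" using CJ(3) comp_zero_left[OF p''(1) D] by simp
    finally obtain d where d: "d \<in> Hom C M' D" "d \<cdot> (q \<cdot> p) = c \<cdot> p" using K(5)[OF cp] by blast
    have "(d \<cdot> q) \<cdot> p = c \<cdot> p" using comp_assoc[OF p q d(1)] d(2) by simp
    then have dq: "d \<cdot> q = c" using is_epiD[OF P(2) p comp_closed[OF q d(1)] c(1)] by blast
    \<comment> \<open>Hence \<open>M''\<close> is contained in \<open>J\<close>: the inclusion
      \<open>j\<close> has a right inverse, and f j = 0 gives f = 0.\<close>
    have "c \<cdot> u = zero_ar C M'' D" using comp_assoc[OF u q d(1)] dq Q(3) comp_zero_right[OF d(1) Ob(5)] by simp
    then obtain t where t: "t \<in> Hom C M'' J" "(u \<cdot> j) \<cdot> t = u" using CJ(4)[OF u] by blast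
    have "u \<cdot> (j \<cdot> t) = u \<cdot> ident C M''" using comp_assoc[OF t(1) j(1) u] t(2) ident_right[OF u] by simp
    then have jt: "j \<cdot> t = ident C M''"
      using is_monoD[OF Q(1) u comp_closed[OF t(1) j(1)] ident_closed[OF Ob(5)]] by blast
    have "f = (f \<cdot> j) \<cdot> t" using comp_assoc[OF t(1) j(1) f(1)] jt ident_right[OF f(1)] by simp
    then have f0: "f = zero_ar C M'' F" using J(1) comp_zero_left[OF t(1) F] by simp
    show ?thesis unfolding is_epi_iff_zero[OF p'(1)]
    proof (intro ballI impI)
      fix W h assume W: "W \<in> Ob C" and h: "h \<in> Hom C M'' W" "h \<cdot> p' = zero_ar C L W"
      then obtain l where "l \<in> Hom C F W" "l \<cdot> f = h" using fp'(2) by blast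
      then show "h = zero_ar C M'' W" using f0 comp_zero_right Ob(5) by metis
    qed
  qed
  ultimately have "short_exact C i' p'" using epi_short_exact p'(1) by blast
  then obtain t where t: "t \<in> Hom C M'' L" "p' \<cdot> t = ident C M''"
    using assms(1) i'(1) p'(1) unfolding splitting_pair_def by blast
  \<comment> \<open>A lift of \<open>u\<close> along \<open>p\<close>, monic because
    \<open>u\<close> is; it realizes \<open>M''\<close> inside \<open>E\<close>.\<close>
  define v where "v = k \<cdot> t"
  have v: "v \<in> Hom C M'' E" unfolding v_def using comp_closed t(1) k(1) by blast
  have "p \<cdot> v = (p \<cdot> k) \<cdot> t" unfolding v_def using comp_assoc[OF t(1) k(1) p] by simp
  also have "\<dots> = u" using comp_assoc[OF t(1) p'(1) u] p'(2) t(2) ident_right[OF u] by simp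
  finally have pv: "p \<cdot> v = u" .
  have vm: "is_mono C v" unfolding is_mono_iff_zero[OF v]
  proof (intro ballI impI)
    fix W h assume W: "W \<in> Ob C" and h: "h \<in> Hom C W M''" "v \<cdot> h = zero_ar C W E"
    have "u \<cdot> h = zero_ar C W M" using comp_assoc[OF h(1) v p] h(2) pv comp_zero_right[OF p W] by simp
    then show "h = zero_ar C W M''" using Q(1) h(1) W unfolding is_mono_iff_zero[OF u] by blast
  qed
  obtain e E' where e: "e \<in> Hom C E E'" "is_cokernel C e v" using cokernelE[OF v] by metis
  note V = short_exactD[OF mono_short_exact[OF vm v e(2)] v e(1)]
  have "(q \<cdot> p) \<cdot> v = zero_ar C M'' M'" using comp_assoc[OF v p q] pv Q(3) by simp
  then obtain q' where q': "q' \<in> Hom C E' M'" "q' \<cdot> e = q \<cdot> p" using V(5)[OF qp] by blast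
  have ei: "e \<cdot> i \<in> Hom C N E'" using comp_closed i e by blast
  \<comment> \<open>\<open>N\<close> and \<open>M''\<close> meet trivially in \<open>E\<close>: p i
    = 0, whereas p v = u is monic.\<close>
  have eim: "is_mono C (e \<cdot> i)" unfolding is_mono_iff_zero[OF ei]
  proof (intro ballI impI)
    fix W h assume W: "W \<in> Ob C" and h: "h \<in> Hom C W N" "(e \<cdot> i) \<cdot> h = zero_ar C W E'"
    have ih: "i \<cdot> h \<in> Hom C W E" using comp_closed h i by blast
    have "e \<cdot> (i \<cdot> h) = zero_ar C W E'" using comp_assoc[OF h(1) i e(1)] h(2) by simp
    then obtain l where l: "l \<in> Hom C W M''" "v \<cdot> l = i \<cdot> h" using V(4)[OF ih] by blast
    have "u \<cdot> l = p \<cdot> (i \<cdot> h)" using comp_assoc[OF l(1) v p] pv l(2) by simp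
    also have "\<dots> = zero_ar C W M" using comp_assoc[OF h(1) i p] P(3) comp_zero_left[OF h(1) Ob(3)] by simp
    finally have "l = zero_ar C W M''" using Q(1) l(1) W unfolding is_mono_iff_zero[OF u] by blast
    then have "i \<cdot> h = zero_ar C W E" using l(2) comp_zero_right[OF v W] by simp
    then show "h = zero_ar C W N" using P(1) h(1) W unfolding is_mono_iff_zero[OF i] by blast
  qed
  have "is_cokernel C q' (e \<cdot> i)"
  proof (rule is_cokernelI[OF q'(1) ei])
    show "q' \<cdot> (e \<cdot> i) = zero_ar C N M'"
      using comp_assoc[OF i e(1) q'(1)] q'(2) \<open>(q \<cdot> p) \<cdot> i = zero_ar C N M'\<close> by simp
    show "is_epi C q'" unfolding is_epi_iff_zero[OF q'(1)]
    proof (intro ballI impI)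
      fix W h assume W: "W \<in> Ob C" and h: "h \<in> Hom C M' W" "h \<cdot> q' = zero_ar C E' W"
      have "h \<cdot> (q \<cdot> p) = zero_ar C E W"
        using comp_assoc[OF e(1) q'(1) h(1)] h(2) q'(2) comp_zero_left[OF e(1) W] by simp
      then show "h = zero_ar C M' W" using qpe h(1) W unfolding is_epi_iff_zero[OF qp] by blast
    qed
  next
    fix W g assume W: "W \<in> Ob C" and g: "g \<in> Hom C E' W" "g \<cdot> (e \<cdot> i) = zero_ar C N W"
    \<comment> \<open>\<open>g\<close> is pushed down twice: g e annihilates \<open>i\<close> and
      factors through \<open>p\<close>; the factor annihilates \<open>u\<close> and factors through
      \<open>q\<close>.\<close>
    have ge: "g \<cdot> e \<in> Hom C E W" using comp_closed g e by blast
    have "(g \<cdot> e) \<cdot> i = zero_ar C N W" using comp_assoc[OF i e(1) g(1)] g(2) by simp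
    then obtain g' where g': "g' \<in> Hom C M W" "g' \<cdot> p = g \<cdot> e" using P(5)[OF ge] by blast
    have "g' \<cdot> u = (g \<cdot> e) \<cdot> v" using comp_assoc[OF v p g'(1)] g'(2) pv by simp
    also have "\<dots> = zero_ar C M'' W"
      using comp_assoc[OF v e(1) g(1)] V(3) comp_zero_right[OF g(1) Ob(5)] by simp
    finally obtain g'' where g'': "g'' \<in> Hom C M' W" "g'' \<cdot> q = g'" using Q(5)[OF g'(1)] by blast
    have "(g'' \<cdot> q') \<cdot> e = g \<cdot> e"
      using comp_assoc[OF e(1) q'(1) g''(1)] comp_assoc[OF p q g''(1)] q'(2) g''(2) g'(2) by simp
    then have "g'' \<cdot> q' = g" using is_epiD[OF V(2) e(1) comp_closed[OF q'(1) g''(1)] g(1)] by blast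
    then show "\<exists>l\<in>Hom C M' W. l \<cdot> q' = g" using g'' by blast
  qed
  then have se': "short_exact C (e \<cdot> i) q'" using mono_short_exact eim ei by blast
  then obtain s' where s': "s' \<in> Hom C M' E'" "q' \<cdot> s' = ident C M'"
    using assms(2) ei q'(1) unfolding splitting_pair_def by blast
  \<comment> \<open>The section \<open>s'\<close> would have to be lifted to \<open>E\<close>,
    whereas the corresponding retraction simply composes with \<open>e\<close>.\<close>
  obtain r where r: "r \<in> Hom C E' N" "r \<cdot> (e \<cdot> i) = ident C N"
    using short_exact_section[OF se' ei q'(1) s'] by metis
  have "(r \<cdot> e) \<cdot> i = ident C N" using comp_assoc[OF i e(1) r(1)] r(2) by simp
  then show "\<exists>s\<in>Hom C M E. p \<cdot> s = ident C M"
    using short_exact_retraction[OF ip i p comp_closed[OF e(1) r(1)]] by blast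
qed

end

section \<open>Tensor products of free vector spaces\<close>

lemma listset_iff: "xs \<in> listset As \<longleftrightarrow> length xs = length As \<and> (\<forall>i<length As. xs ! i \<in> As ! i)"
proof (induction As arbitrary: xs)
  case (Cons A As)
  show ?case
    by (cases xs) (auto simp: set_Cons_def Cons less_Suc_eq_0_disj)
qed auto

lemma free_space_carrier:
  "f \<in> carrier (free_space B) \<longleftrightarrow> finite {b. f b \<noteq> 0} \<and> {b. f b \<noteq> 0} \<subseteq> B"
  by (simp add: free_space_def)

lemma free_space_simps:
  "\<zero>\<^bsub>free_space B\<^esub> = (\<lambda>b. 0)" "f \<oplus>\<^bsub>free_space B\<^esub> g = (\<lambda>b. f b + g b)"
  "c \<odot>\<^bsub>free_space B\<^esub> f = (\<lambda>b. c * f b)"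
  by (simp_all add: free_space_def)

lemma free_space_zero: "(\<lambda>b. 0) \<in> carrier (free_space B)"
  by (simp add: free_space_carrier)

lemma free_space_single: "b \<in> B \<Longrightarrow> single b \<in> carrier (free_space B)"
  by (auto simp: free_space_carrier single_def)

lemma free_space_add:
  assumes "f \<in> carrier (free_space B)" "g \<in> carrier (free_space B)"
  shows "(\<lambda>b. f b + g b) \<in> carrier (free_space B)"
proof -
  have "{b. f b + g b \<noteq> 0} \<subseteq> {b. f b \<noteq> 0} \<union> {b. g b \<noteq> 0}" by auto
  then show ?thesis using assms unfolding free_space_carrier
    by (meson finite_UnI finite_subset le_supI order_trans)
qed

lemma free_space_scale:
  assumes "f \<in> carrier (free_space B)"
  shows "(\<lambda>b. c * f b) \<in> carrier (free_space B)"
proof -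
  have "{b. c * f b \<noteq> 0} \<subseteq> {b. f b \<noteq> 0}" by auto
  then show ?thesis using assms unfolding free_space_carrier by (meson finite_subset order_trans)
qed

lemma module_free_space: "module rat_field (free_space B)"
proof (rule moduleI)
  show "cring rat_field"
  proof (rule cringI)
    show "abelian_group rat_field"
      by (rule abelian_groupI) (auto simp: rat_field_def algebra_simps intro: exI[of _ "- x" for x])
    show "comm_monoid rat_field"
      by (rule comm_monoidI) (auto simp: rat_field_def)
  qed (auto simp: rat_field_def algebra_simps)
  show "abelian_group (free_space B)"
  proof (rule abelian_groupI)
    fix f assume "f \<in> carrier (free_space B)"
    then show "\<exists>g\<in>carrier (free_space B). g \<oplus>\<^bsub>free_space B\<^esub> f = \<zero>\<^bsub>free_space B\<^esub>"
      by (intro bexI[OF _ free_space_scale[of f B "-1"]]) (auto simp: free_space_simps)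
  qed (auto simp: free_space_simps free_space_add free_space_zero algebra_simps)
qed (auto simp: free_space_simps free_space_scale rat_field_def algebra_simps)

text \<open>Closure under negatives, which \<open>submodule\<close> demands, comes from scaling by
  -1.\<close>

lemma submodule_free_spaceI:
  assumes "W \<subseteq> carrier (free_space B)" "(\<lambda>b. 0) \<in> W"
    and add: "\<And>f g. f \<in> W \<Longrightarrow> g \<in> W \<Longrightarrow> (\<lambda>b. f b + g b) \<in> W"
    and scale: "\<And>c f. f \<in> W \<Longrightarrow> (\<lambda>b. c * f b) \<in> W"
  shows "submodule W rat_field (free_space B)"
proof -
  interpret module rat_field "free_space B" by (rule module_free_space)
  show ?thesis
  proof (rule submoduleI)
    fix f assume f: "f \<in> W"
    have "f \<oplus>\<^bsub>free_space B\<^esub> (\<lambda>b. -1 * f b) = \<zero>\<^bsub>free_space B\<^esub>" by (simp add: free_space_simps)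
    moreover have "f \<in> carrier (free_space B)" "(\<lambda>b. -1 * f b) \<in> carrier (free_space B)"
      using f assms(1) scale by blast+
    ultimately have "\<ominus>\<^bsub>free_space B\<^esub> f = (\<lambda>b. -1 * f b)"
      using M.minus_equality M.a_comm by metis
    then show "\<ominus>\<^bsub>free_space B\<^esub> f \<in> W" using scale[OF f, of "-1"] by simp
  qed (use assms in \<open>auto simp: free_space_simps\<close>)
qed

lemma submodule_free_spaceD:
  assumes "submodule W rat_field (free_space B)"
  shows "W \<subseteq> carrier (free_space B)" "(\<lambda>b. 0) \<in> W"
    "\<And>f g. f \<in> W \<Longrightarrow> g \<in> W \<Longrightarrow> (\<lambda>b. f b + g b) \<in> W"
    "\<And>c f. f \<in> W \<Longrightarrow> (\<lambda>b. c * f b) \<in> W"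
proof -
  interpret submodule W rat_field "free_space B" by fact
  show "W \<subseteq> carrier (free_space B)" "(\<lambda>b. 0) \<in> W"
    "\<And>f g. f \<in> W \<Longrightarrow> g \<in> W \<Longrightarrow> (\<lambda>b. f b + g b) \<in> W"
    using subset one_closed m_closed by (simp_all add: free_space_simps)
  show "\<And>c f. f \<in> W \<Longrightarrow> (\<lambda>b. c * f b) \<in> W"
    using smult_closed by (simp add: free_space_simps rat_field_def)
qed

lemma span_in_superset: "G \<subseteq> span_in V G"
  unfolding span_in_def by blast

lemma span_in_least: "submodule W rat_field V \<Longrightarrow> G \<subseteq> W \<Longrightarrow> span_in V G \<subseteq> W"
  unfolding span_in_def by blast

lemma submodule_span_in:
  assumes "G \<subseteq> carrier (free_space B)"
  shows "submodule (span_in (free_space B) G) rat_field (free_space B)"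
proof (rule submodule_free_spaceI)
  show "span_in (free_space B) G \<subseteq> carrier (free_space B)"
    by (rule span_in_least[OF module.carrier_is_submodule[OF module_free_space] assms])
qed (auto simp: span_in_def dest: submodule_free_spaceD)

text \<open>Induction on a finite set containing the support: the coefficient at one index is split
  off, and the rest is supported on a smaller set.\<close>

lemma free_space_induct [consumes 1, case_names zero add]:
  assumes "f \<in> carrier (free_space B)" "P (\<lambda>b. 0)"
    and step: "\<And>b c g. b \<in> B \<Longrightarrow> g \<in> carrier (free_space B) \<Longrightarrow> P g \<Longrightarrow> P (\<lambda>x. c * single b x + g x)"
  shows "P f"
proof -
  have "P f" if "finite S" "S \<subseteq> B" "{b. f b \<noteq> 0} \<subseteq> S" for S f
    using that
  proof (induction S arbitrary: f rule: finite_induct)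
    case empty
    then have "f = (\<lambda>b. 0)" by auto
    then show ?case using assms(2) by simp
  next
    case (insert a S)
    let ?g = "f(a := 0)"
    have g: "{b. ?g b \<noteq> 0} \<subseteq> S" using insert.prems by auto
    then have "?g \<in> carrier (free_space B)"
      unfolding free_space_carrier using insert by (meson finite_subset insert_subset order_trans)
    then have "P (\<lambda>x. f a * single a x + ?g x)" using step insert.IH[OF _ g] insert.prems by blast
    moreover have "(\<lambda>x. f a * single a x + ?g x) = f" by (auto simp: single_def)
    ultimately show ?case by simp
  qed
  then show ?thesis using assms(1) unfolding free_space_carrier by blast
qed

text \<open>The first isomorphism theorem, run backwards: \<open>v\<close> is sent to its fibre
  under \<open>\<Phi>\<close>, which is a coset of the kernel \<open>R\<close>. In this direction no
  representatives of cosets have to be chosen.\<close>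

lemma isomorphic_spaces_quotient:
  fixes \<Phi> :: "('a \<Rightarrow> rat) \<Rightarrow> ('b \<Rightarrow> rat)"
  assumes closed: "\<And>f. f \<in> carrier (free_space X) \<Longrightarrow> \<Phi> f \<in> carrier (free_space I)"
    and surj: "\<And>w. w \<in> carrier (free_space I) \<Longrightarrow> \<exists>f\<in>carrier (free_space X). \<Phi> f = w"
    and add: "\<And>f g. f \<in> carrier (free_space X) \<Longrightarrow> g \<in> carrier (free_space X) \<Longrightarrow>
        \<Phi> (\<lambda>x. f x + g x) = (\<lambda>y. \<Phi> f y + \<Phi> g y)"
    and scale: "\<And>c f. f \<in> carrier (free_space X) \<Longrightarrow> \<Phi> (\<lambda>x. c * f x) = (\<lambda>y. c * \<Phi> f y)"
    and R: "R = {f \<in> carrier (free_space X). \<Phi> f = (\<lambda>y. 0)}"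
  shows "isomorphic_spaces (free_space I) (quotient_space (free_space X) R)"
proof -
  define fib where "fib v = {f \<in> carrier (free_space X). \<Phi> f = v}" for v
  have diff: "(\<lambda>x. f x + -1 * g x) \<in> carrier (free_space X)"
    "\<Phi> (\<lambda>x. f x + -1 * g x) = (\<lambda>y. \<Phi> f y + -1 * \<Phi> g y)"
    if "f \<in> carrier (free_space X)" "g \<in> carrier (free_space X)" for f g
    using that free_space_add[OF that(1) free_space_scale[OF that(2), of "-1"]]
      add[OF that(1) free_space_scale[OF that(2), of "-1"]] scale[OF that(2), of "-1"] by simp_all
  have coset: "R +>\<^bsub>free_space X\<^esub> x = fib (\<Phi> x)" if x: "x \<in> carrier (free_space X)" for x
  proof (intro equalityI subsetI)
    fix f assume "f \<in> R +>\<^bsub>free_space X\<^esub> x"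
    then obtain h where "h \<in> R" "f = (\<lambda>b. h b + x b)"
      by (auto simp: a_r_coset_def r_coset_def free_space_def)
    then show "f \<in> fib (\<Phi> x)" unfolding fib_def R using add[OF _ x] free_space_add[OF _ x] by auto
  next
    fix f assume "f \<in> fib (\<Phi> x)"
    then have f: "f \<in> carrier (free_space X)" "\<Phi> f = \<Phi> x" unfolding fib_def by auto
    then have "(\<lambda>b. f b + -1 * x b) \<in> R" unfolding R using diff[OF f(1) x] by simp
    moreover have "f = (\<lambda>b. f b + -1 * x b) \<oplus>\<^bsub>free_space X\<^esub> x" by (simp add: free_space_simps)
    ultimately show "f \<in> R +>\<^bsub>free_space X\<^esub> x"
      unfolding a_r_coset_def r_coset_def by auto
  qed
  have "bij_betw fib (carrier (free_space I)) (carrier (quotient_space (free_space X) R))"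
    unfolding bij_betw_def
  proof
    show "inj_on fib (carrier (free_space I))"
      by (rule inj_onI) (use surj in \<open>auto simp: fib_def\<close>)
    have "carrier (quotient_space (free_space X) R) = (\<lambda>x. fib (\<Phi> x)) ` carrier (free_space X)"
      using coset by (auto simp: quotient_space_def A_RCOSETS_def RCOSETS_def a_r_coset_def)
    also have "\<dots> = fib ` (\<Phi> ` carrier (free_space X))" by auto
    also have "\<Phi> ` carrier (free_space X) = carrier (free_space I)" using closed surj by auto
    finally show "fib ` carrier (free_space I) = carrier (quotient_space (free_space X) R)" ..
  qed
  moreover have "fib (v \<oplus>\<^bsub>free_space I\<^esub> w) = fib v \<oplus>\<^bsub>quotient_space (free_space X) R\<^esub> fib w"
    if vw: "v \<in> carrier (free_space I)" "w \<in> carrier (free_space I)" for v w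
  proof -
    have "fib v \<oplus>\<^bsub>quotient_space (free_space X) R\<^esub> fib w = {(\<lambda>x. f x + g x) | f g. f \<in> fib v \<and> g \<in> fib w}"
      by (auto simp: quotient_space_def set_add_def set_mult_def free_space_def)
    also have "\<dots> = fib (\<lambda>y. v y + w y)"
    proof (intro equalityI subsetI)
      fix h assume "h \<in> {(\<lambda>x. f x + g x) | f g. f \<in> fib v \<and> g \<in> fib w}"
      then show "h \<in> fib (\<lambda>y. v y + w y)" using add free_space_add unfolding fib_def by auto
    next
      fix h assume h: "h \<in> fib (\<lambda>y. v y + w y)"
      obtain g where g: "g \<in> carrier (free_space X)" "\<Phi> g = w" using surj vw(2) by blast
      have "(\<lambda>x. h x + -1 * g x) \<in> fib v" using h g diff unfolding fib_def by auto
      moreover have "g \<in> fib w" using g unfolding fib_def by simp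
      moreover have "h = (\<lambda>x. (h x + -1 * g x) + g x)" by simp
      ultimately show "h \<in> {(\<lambda>x. f x + g x) | f g. f \<in> fib v \<and> g \<in> fib w}"
        by (intro CollectI exI conjI)
    qed
    finally show ?thesis by (simp add: free_space_simps)
  qed
  moreover have "fib (c \<odot>\<^bsub>free_space I\<^esub> v) = c \<odot>\<^bsub>quotient_space (free_space X) R\<^esub> fib v"
    if "v \<in> carrier (free_space I)" for c v
  proof -
    have "c \<odot>\<^bsub>quotient_space (free_space X) R\<^esub> fib v =
        (\<Union>x\<in>fib v. R +>\<^bsub>free_space X\<^esub> (\<lambda>b. c * x b))"
      by (simp add: quotient_space_def free_space_simps)
    also have "\<dots> = (\<Union>x\<in>fib v. fib (\<lambda>y. c * v y))"
    proof (intro SUP_cong refl)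
      fix x assume "x \<in> fib v"
      then show "R +>\<^bsub>free_space X\<^esub> (\<lambda>b. c * x b) = fib (\<lambda>y. c * v y)"
        using coset[OF free_space_scale] scale unfolding fib_def[of v] by simp
    qed
    \<comment> \<open>All members of the union are the same set; surjectivity makes the index set
      \<open>fib v\<close> nonempty, so the union is that set.\<close>
    also have "\<dots> = fib (\<lambda>y. c * v y)" using surj[OF that] unfolding fib_def[of v] by auto
    finally show ?thesis by (simp add: free_space_simps)
  qed
  ultimately show ?thesis unfolding isomorphic_spaces_def by blast
qed

text \<open>\<open>\<beta>\<close> lets the basis be indexed by any set in bijection with the tuples
  of basis elements; in the application these are the isomorphism classes of the whole category.
  \<open>Vs\<close> is described only by carrier, addition and scaling because Hall algebras also
  carry a multiplication.\<close>

locale tensor_of_free_spaces =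
  fixes Vs :: "(rat, 'b \<Rightarrow> rat) module list" and Bs :: "'b set list"
    and I :: "'c set" and \<beta> :: "'c \<Rightarrow> 'b list"
  assumes length_Bs: "length Bs = length Vs"
    and carrier_Vs: "i < length Vs \<Longrightarrow> carrier (Vs ! i) = carrier (free_space (Bs ! i))"
    and add_Vs: "i < length Vs \<Longrightarrow> x \<oplus>\<^bsub>Vs ! i\<^esub> y = (\<lambda>b. x b + y b)"
    and smult_Vs: "i < length Vs \<Longrightarrow> c \<odot>\<^bsub>Vs ! i\<^esub> x = (\<lambda>b. c * x b)"
    and bij: "bij_betw \<beta> I (listset Bs)"
begin

section \<open>Multilinear coordinates on tuples of vectors\<close>

abbreviation X where "X \<equiv> listset (map carrier Vs)"
abbreviation F where "F \<equiv> free_space X"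
abbreviation R where "R \<equiv> span_in F (tensor_relations Vs)"

lemma X_iff: "vs \<in> X \<longleftrightarrow> length vs = length Vs \<and> (\<forall>i<length Vs. vs ! i \<in> carrier (free_space (Bs ! i)))"
  by (auto simp: listset_iff carrier_Vs)

lemma X_update: "vs \<in> X \<Longrightarrow> i < length Vs \<Longrightarrow> x \<in> carrier (free_space (Bs ! i)) \<Longrightarrow> vs[i := x] \<in> X"
  by (auto simp: X_iff nth_list_update)

text \<open>The coordinate of the pure tensor of \<open>vs\<close> at the basis element indexed by
  \<open>K\<close>.\<close>

definition coefficient :: "('b \<Rightarrow> rat) list \<Rightarrow> 'c \<Rightarrow> rat" where
  "coefficient vs K = (if K \<in> I then \<Prod>i<length Vs. (vs ! i) (\<beta> K ! i) else 0)"

text \<open>The linear extension of \<open>coefficient\<close> to formal sums of tuples; its kernel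
  turns out to be the span of the relations.\<close>

definition \<Phi> :: "(('b \<Rightarrow> rat) list \<Rightarrow> rat) \<Rightarrow> 'c \<Rightarrow> rat" where
  "\<Phi> f K = (\<Sum>vs | f vs \<noteq> 0. f vs * coefficient vs K)"

text \<open>Supports may shrink under addition or scaling, so sums are compared over a common finite
  set.\<close>

lemma \<Phi>_superset:
  assumes "finite A" "{vs. f vs \<noteq> 0} \<subseteq> A"
  shows "\<Phi> f K = (\<Sum>vs\<in>A. f vs * coefficient vs K)"
  unfolding \<Phi>_def by (rule sum.mono_neutral_left[OF assms]) auto

lemma \<Phi>_add:
  assumes "f \<in> carrier F" "g \<in> carrier F"
  shows "\<Phi> (\<lambda>x. f x + g x) = (\<lambda>y. \<Phi> f y + \<Phi> g y)"
proof
  fix K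
  let ?A = "{vs. f vs \<noteq> 0} \<union> {vs. g vs \<noteq> 0}"
  have A: "finite ?A" using assms by (simp add: free_space_carrier)
  have "\<Phi> (\<lambda>x. f x + g x) K = (\<Sum>vs\<in>?A. (f vs + g vs) * coefficient vs K)"
    by (rule \<Phi>_superset[OF A]) auto
  moreover have "\<Phi> f K = (\<Sum>vs\<in>?A. f vs * coefficient vs K)" by (rule \<Phi>_superset[OF A]) auto
  moreover have "\<Phi> g K = (\<Sum>vs\<in>?A. g vs * coefficient vs K)" by (rule \<Phi>_superset[OF A]) auto
  ultimately show "\<Phi> (\<lambda>x. f x + g x) K = \<Phi> f K + \<Phi> g K" by (simp add: algebra_simps sum.distrib)
qed

lemma \<Phi>_scale:
  assumes "f \<in> carrier F"
  shows "\<Phi> (\<lambda>x. c * f x) = (\<lambda>y. c * \<Phi> f y)"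
proof
  fix K
  have "\<Phi> (\<lambda>x. c * f x) K = (\<Sum>vs | f vs \<noteq> 0. c * f vs * coefficient vs K)"
    by (rule \<Phi>_superset) (use assms in \<open>auto simp: free_space_carrier\<close>)
  then show "\<Phi> (\<lambda>x. c * f x) K = c * \<Phi> f K" by (simp add: \<Phi>_def sum_distrib_left mult.assoc)
qed

lemma \<Phi>_single: "\<Phi> (single vs) = coefficient vs"
proof
  fix K show "\<Phi> (single vs) K = coefficient vs K"
    using \<Phi>_superset[of "{vs}" "single vs" K] by (auto simp: single_def split: if_splits)
qed

text \<open>\<open>\<beta>\<close> embeds the support into the lists of fixed length over the finite
  union of the supports of the entries.\<close>

lemma coefficient_closed:
  assumes "vs \<in> X"
  shows "coefficient vs \<in> carrier (free_space I)"
proof -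
  let ?S = "\<Union>i<length Vs. {b. (vs ! i) b \<noteq> 0}"
  have "finite ?S" using assms unfolding X_iff free_space_carrier by blast
  moreover have "\<beta> ` {K. coefficient vs K \<noteq> 0} \<subseteq> {xs. set xs \<subseteq> ?S \<and> length xs = length Vs}"
  proof
    fix xs assume "xs \<in> \<beta> ` {K. coefficient vs K \<noteq> 0}"
    then obtain K where K: "xs = \<beta> K" "K \<in> I" "(\<Prod>i<length Vs. (vs ! i) (\<beta> K ! i)) \<noteq> 0"
      by (auto simp: coefficient_def split: if_splits)
    then have "length xs = length Vs" using bij_betwE[OF bij] by (auto simp: listset_iff length_Bs)
    moreover have "xs ! i \<in> ?S" if "i < length Vs" for i
      using K(1,3) that by auto
    ultimately show "xs \<in> {xs. set xs \<subseteq> ?S \<and> length xs = length Vs}"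
      by (auto simp: in_set_conv_nth)
  qed
  ultimately have "finite (\<beta> ` {K. coefficient vs K \<noteq> 0})"
    using finite_lists_length_eq finite_subset by blast
  moreover have I: "{K. coefficient vs K \<noteq> 0} \<subseteq> I" by (auto simp: coefficient_def)
  ultimately show ?thesis unfolding free_space_carrier
    using finite_imageD inj_on_subset[OF bij_betw_imp_inj_on[OF bij]] by blast
qed

lemma \<Phi>_closed:
  assumes "f \<in> carrier F"
  shows "\<Phi> f \<in> carrier (free_space I)"
  using assms
proof (induction rule: free_space_induct)
  case zero
  have "\<Phi> (\<lambda>b. 0) = (\<lambda>K. 0)" by (auto simp: \<Phi>_def)
  then show ?case by (simp add: free_space_zero)
next
  case (add b c g)
  have "\<Phi> (\<lambda>x. c * single b x + g x) = (\<lambda>y. c * coefficient b y + \<Phi> g y)"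
    using \<Phi>_add[OF free_space_scale[OF free_space_single] add(2)] \<Phi>_scale[OF free_space_single] add(1)
    by (simp add: \<Phi>_single)
  then show ?case
    using free_space_add[OF free_space_scale[OF coefficient_closed] add(3)] add(1) by simp
qed

text \<open>One entry is isolated so that linearity in it becomes visible; this multilinearity
  annihilates the tensor relations.\<close>

lemma coefficient_update:
  assumes "i < length Vs" "length vs = length Vs"
  shows "coefficient (vs[i := x]) K =
    (if K \<in> I then x (\<beta> K ! i) * (\<Prod>j\<in>{..<length Vs} - {i}. (vs ! j) (\<beta> K ! j)) else 0)"
proof -
  have "(\<Prod>j<length Vs. (vs[i := x] ! j) (\<beta> K ! j)) =
      x (\<beta> K ! i) * (\<Prod>j\<in>{..<length Vs} - {i}. (vs[i := x] ! j) (\<beta> K ! j))"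
    using assms by (subst prod.remove[of _ i]) auto
  also have "(\<Prod>j\<in>{..<length Vs} - {i}. (vs[i := x] ! j) (\<beta> K ! j)) =
      (\<Prod>j\<in>{..<length Vs} - {i}. (vs ! j) (\<beta> K ! j))"
    by (rule prod.cong) auto
  finally show ?thesis by (simp add: coefficient_def)
qed

section \<open>Tensor relations and the kernel of the coordinate map\<close>

lemma tensor_relation_add:
  assumes "vs \<in> X" "i < length Vs" "x \<in> carrier (free_space (Bs ! i))" "y \<in> carrier (free_space (Bs ! i))"
  shows "(\<lambda>t. single (vs[i := (\<lambda>b. x b + y b)]) t - single (vs[i := x]) t - single (vs[i := y]) t)
    \<in> tensor_relations Vs"
  unfolding tensor_relations_def
  by (intro UnI1 CollectI exI[of _ vs] exI[of _ i] exI[of _ x] exI[of _ y])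
    (simp add: assms add_Vs carrier_Vs)

lemma tensor_relation_scale:
  assumes "vs \<in> X" "i < length Vs" "x \<in> carrier (free_space (Bs ! i))"
  shows "(\<lambda>t. single (vs[i := (\<lambda>b. c * x b)]) t - c * single (vs[i := x]) t) \<in> tensor_relations Vs"
  unfolding tensor_relations_def
  by (intro UnI2 CollectI exI[of _ vs] exI[of _ i] exI[of _ c] exI[of _ x])
    (simp add: assms smult_Vs carrier_Vs)

text \<open>Differences are rewritten as sums with negative scalars, the form to which
  \<open>\<Phi>_add\<close> and \<open>\<Phi>_scale\<close> apply.\<close>

lemma tensor_relations_cases:
  assumes "r \<in> tensor_relations Vs"
  obtains vs i x y where "vs \<in> X" "i < length Vs" "x \<in> carrier (free_space (Bs ! i))"
      "y \<in> carrier (free_space (Bs ! i))"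
      "r = (\<lambda>t. single (vs[i := (\<lambda>b. x b + y b)]) t + -1 * (single (vs[i := x]) t + single (vs[i := y]) t))"
  | vs i c x where "vs \<in> X" "i < length Vs" "x \<in> carrier (free_space (Bs ! i))"
      "r = (\<lambda>t. single (vs[i := (\<lambda>b. c * x b)]) t + (- c) * single (vs[i := x]) t)"
  using assms unfolding tensor_relations_def
  by (auto simp: add_Vs smult_Vs carrier_Vs algebra_simps)

lemma tensor_relations_kernel: "tensor_relations Vs \<subseteq> {f \<in> carrier F. \<Phi> f = (\<lambda>K. 0)}"
proof
  fix r assume "r \<in> tensor_relations Vs"
  then show "r \<in> {f \<in> carrier F. \<Phi> f = (\<lambda>K. 0)}"
  proof (cases rule: tensor_relations_cases)
    case (1 vs i x y)
    have len: "length vs = length Vs" using 1 by (simp add: X_iff)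
    have c: "single (vs[i := (\<lambda>b. x b + y b)]) \<in> carrier F" "single (vs[i := x]) \<in> carrier F"
      "single (vs[i := y]) \<in> carrier F"
      using 1 by (auto intro!: free_space_single X_update free_space_add)
    have "\<Phi> r = (\<lambda>K. 0)"
      unfolding 1(5)
      by (subst \<Phi>_add[OF c(1) free_space_scale[OF free_space_add[OF c(2,3)]]],
          subst \<Phi>_scale[OF free_space_add[OF c(2,3)]], subst \<Phi>_add[OF c(2,3)])
        (auto simp: \<Phi>_single coefficient_update[OF 1(2) len] algebra_simps)
    moreover have "r \<in> carrier F"
      unfolding 1(5) using free_space_add[OF c(1) free_space_scale[OF free_space_add[OF c(2,3)]]] .
    ultimately show ?thesis by simp
  next
    case (2 vs i c x)
    have len: "length vs = length Vs" using 2 by (simp add: X_iff)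
    have cl: "single (vs[i := (\<lambda>b. c * x b)]) \<in> carrier F" "single (vs[i := x]) \<in> carrier F"
      using 2 by (auto intro!: free_space_single X_update free_space_scale)
    have "\<Phi> r = (\<lambda>K. 0)"
      unfolding 2(4)
      by (subst \<Phi>_add[OF cl(1) free_space_scale[OF cl(2)]], subst \<Phi>_scale[OF cl(2)])
        (auto simp: \<Phi>_single coefficient_update[OF 2(2) len] algebra_simps)
    moreover have "r \<in> carrier F"
      unfolding 2(4) using free_space_add[OF cl(1) free_space_scale[OF cl(2)]] .
    ultimately show ?thesis by simp
  qed
qed

lemma R_kernel: "R \<subseteq> {f \<in> carrier F. \<Phi> f = (\<lambda>K. 0)}"
proof (rule span_in_least[OF submodule_free_spaceI tensor_relations_kernel])
  show "(\<lambda>b. 0) \<in> {f \<in> carrier F. \<Phi> f = (\<lambda>K. 0)}" using free_space_zero by (auto simp: \<Phi>_def)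
qed (auto simp: free_space_add free_space_scale \<Phi>_add \<Phi>_scale)

lemma submodule_R: "submodule R rat_field F"
  using submodule_span_in tensor_relations_kernel by blast

lemmas R_closed = submodule_free_spaceD[OF submodule_R]

section \<open>A right inverse of the coordinate map, and reduction to basis tuples\<close>

definition basis_tuple :: "'c \<Rightarrow> ('b \<Rightarrow> rat) list" where
  "basis_tuple K = map single (\<beta> K)"

text \<open>\<open>w\<close> becomes the formal sum of the basis tuples with coefficients w K. Using
  the inverse of \<open>basis_tuple\<close> makes this a pointwise formula, visibly linear in
  \<open>w\<close>.\<close>

definition \<sigma> :: "('c \<Rightarrow> rat) \<Rightarrow> ('b \<Rightarrow> rat) list \<Rightarrow> rat" where
  "\<sigma> w vs = (if vs \<in> basis_tuple ` I then w (the_inv_into I basis_tuple vs) else 0)"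

lemma \<beta>_nth: "K \<in> I \<Longrightarrow> length (\<beta> K) = length Vs \<and> (\<forall>i<length Vs. \<beta> K ! i \<in> Bs ! i)"
  using bij_betwE[OF bij] by (simp add: listset_iff length_Bs)

lemma basis_tuple_X: "K \<in> I \<Longrightarrow> basis_tuple K \<in> X"
  using \<beta>_nth by (simp add: basis_tuple_def X_iff free_space_single)

text \<open>The coordinates are dual to the basis tuples: a position where two tuples differ
  contributes a factor 0. Injectivity of \<open>basis_tuple\<close> follows.\<close>

lemma coefficient_basis_tuple:
  assumes "K \<in> I"
  shows "coefficient (basis_tuple K) L = (if L = K then 1 else 0)"
proof (cases "L \<in> I")
  case True
  have "coefficient (basis_tuple K) L = (\<Prod>i<length Vs. single (\<beta> K ! i) (\<beta> L ! i))"
    using True \<beta>_nth[OF assms] by (auto simp: coefficient_def basis_tuple_def intro!: prod.cong)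
  also have "\<dots> = (if \<beta> L = \<beta> K then 1 else 0)"
  proof (cases "\<beta> L = \<beta> K")
    case False
    then obtain i where "i < length Vs" "\<beta> L ! i \<noteq> \<beta> K ! i"
      using \<beta>_nth[OF True] \<beta>_nth[OF assms] by (metis nth_equalityI)
    then show ?thesis using False by (auto simp: single_def intro!: prod_zero)
  qed (simp add: single_def)
  also have "\<beta> L = \<beta> K \<longleftrightarrow> L = K" using bij_betw_imp_inj_on[OF bij] True assms by (auto dest: inj_onD)
  finally show ?thesis .
qed (use assms in \<open>auto simp: coefficient_def\<close>)

lemma inj_basis_tuple: "inj_on basis_tuple I"
  by (rule inj_onI) (metis coefficient_basis_tuple zero_neq_one)

lemma \<sigma>_basis_tuple: "K \<in> I \<Longrightarrow> \<sigma> w (basis_tuple K) = w K"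
  by (simp add: \<sigma>_def the_inv_into_f_f[OF inj_basis_tuple])

lemma \<sigma>_support:
  assumes "w \<in> carrier (free_space I)"
  shows "{vs. \<sigma> w vs \<noteq> 0} = basis_tuple ` {K. w K \<noteq> 0}"
proof -
  have "{K. w K \<noteq> 0} \<subseteq> I" using assms by (simp add: free_space_carrier)
  then have "\<sigma> w (basis_tuple K) \<noteq> 0" if "w K \<noteq> 0" for K using that \<sigma>_basis_tuple by auto
  moreover have "\<exists>K. vs = basis_tuple K \<and> w K \<noteq> 0" if "\<sigma> w vs \<noteq> 0" for vs
  proof -
    obtain K where "K \<in> I" "vs = basis_tuple K"
      using \<open>\<sigma> w vs \<noteq> 0\<close> by (auto simp: \<sigma>_def split: if_splits)
    then show ?thesis using \<open>\<sigma> w vs \<noteq> 0\<close> \<sigma>_basis_tuple by auto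
  qed
  ultimately show ?thesis by auto
qed

lemma \<sigma>_closed: "w \<in> carrier (free_space I) \<Longrightarrow> \<sigma> w \<in> carrier F"
  using basis_tuple_X unfolding free_space_carrier[of "\<sigma> w"] by (auto simp: \<sigma>_support) (auto simp: free_space_carrier)

lemma \<Phi>_\<sigma>:
  assumes w: "w \<in> carrier (free_space I)"
  shows "\<Phi> (\<sigma> w) = w"
proof
  fix L
  have S: "finite {K. w K \<noteq> 0}" "{K. w K \<noteq> 0} \<subseteq> I" using w by (auto simp: free_space_carrier)
  have "\<Phi> (\<sigma> w) L = (\<Sum>vs\<in>basis_tuple ` {K. w K \<noteq> 0}. \<sigma> w vs * coefficient vs L)"
    by (simp add: \<Phi>_def \<sigma>_support[OF w])
  also have "\<dots> = (\<Sum>K | w K \<noteq> 0. \<sigma> w (basis_tuple K) * coefficient (basis_tuple K) L)"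
    using sum.reindex[OF inj_on_subset[OF inj_basis_tuple S(2)]] by simp
  also have "\<dots> = (\<Sum>K | w K \<noteq> 0. if L = K then w K else 0)"
    by (rule sum.cong) (use S in \<open>auto simp: \<sigma>_basis_tuple coefficient_basis_tuple\<close>)
  also have "\<dots> = w L" using S by (simp add: sum.delta)
  finally show "\<Phi> (\<sigma> w) L = w L" .
qed

text \<open>
  As \<open>\<Phi> \<circ> \<sigma> = id\<close>, a reducible element of the kernel of \<open>\<Phi>\<close> lies in \<open>R\<close>. That every element is reducible
  is shown by replacing the entries of a tuple with basis vectors one position at a time.
\<close>

definition reducible :: "(('b \<Rightarrow> rat) list \<Rightarrow> rat) set" where
  "reducible = {f. \<exists>w\<in>carrier (free_space I). (\<lambda>t. f t - \<sigma> w t) \<in> R}"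

lemma reducible_R: "r \<in> R \<Longrightarrow> r \<in> reducible"
  unfolding reducible_def using free_space_zero[of I]
  by (auto intro!: bexI[of _ "\<lambda>_. 0"] simp: \<sigma>_def)

lemma reducible_add:
  assumes "f \<in> reducible" "g \<in> reducible"
  shows "(\<lambda>t. f t + g t) \<in> reducible"
proof -
  obtain v w where "v \<in> carrier (free_space I)" "(\<lambda>t. f t - \<sigma> v t) \<in> R"
    "w \<in> carrier (free_space I)" "(\<lambda>t. g t - \<sigma> w t) \<in> R"
    using assms unfolding reducible_def by blast
  moreover have "(\<lambda>t. f t + g t - \<sigma> (\<lambda>b. v b + w b) t) = (\<lambda>t. (f t - \<sigma> v t) + (g t - \<sigma> w t))"
    by (auto simp: \<sigma>_def)
  ultimately show ?thesis
    unfolding reducible_def using R_closed(3) free_space_add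
    by (intro CollectI bexI[of _ "\<lambda>b. v b + w b"]) auto
qed

lemma reducible_scale:
  assumes "f \<in> reducible"
  shows "(\<lambda>t. c * f t) \<in> reducible"
proof -
  obtain v where "v \<in> carrier (free_space I)" "(\<lambda>t. f t - \<sigma> v t) \<in> R"
    using assms unfolding reducible_def by blast
  moreover have "(\<lambda>t. c * f t - \<sigma> (\<lambda>b. c * v b) t) = (\<lambda>t. c * (f t - \<sigma> v t))"
    by (auto simp: \<sigma>_def algebra_simps)
  ultimately show ?thesis
    unfolding reducible_def using R_closed(4) free_space_scale
    by (intro CollectI bexI[of _ "\<lambda>b. c * v b"]) auto
qed

text \<open>Expansion of \<open>x\<close> in the basis: each summand is split off by an additivity
  relation, and its scalar by a homogeneity relation.\<close>

lemma reducible_update: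
  assumes "vs \<in> X" "k < length Vs" "x \<in> carrier (free_space (Bs ! k))"
    and basis: "\<And>b. b \<in> Bs ! k \<Longrightarrow> single (vs[k := single b]) \<in> reducible"
  shows "single (vs[k := x]) \<in> reducible"
  using assms(3)
proof (induction rule: free_space_induct)
  case zero
  \<comment> \<open>The homogeneity relation with scalar 0 puts a tuple with a zero entry into
    \<open>R\<close>.\<close>
  show ?case
    using reducible_R[OF subsetD[OF span_in_superset
          tensor_relation_scale[OF assms(1,2) free_space_zero, of 0]]] by simp
next
  case (add b c g)
  note b = free_space_single[OF add(1)]
  note cb = free_space_scale[OF b, of c]
  let ?cb = "\<lambda>x. c * single b x"
  have r: "(\<lambda>t. single (vs[k := (\<lambda>x. ?cb x + g x)]) t - single (vs[k := ?cb]) t - single (vs[k := g]) t)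
      \<in> reducible"
    "(\<lambda>t. single (vs[k := ?cb]) t - c * single (vs[k := single b]) t) \<in> reducible"
    by (rule reducible_R, rule subsetD[OF span_in_superset], rule tensor_relation_add[OF assms(1,2) cb add(2)])
      (rule reducible_R, rule subsetD[OF span_in_superset], rule tensor_relation_scale[OF assms(1,2) b])
  have s: "single (vs[k := ?cb]) \<in> reducible"
    using reducible_add[OF r(2) reducible_scale[OF basis[OF add(1)], of c]] by simp
  show ?case using reducible_add[OF reducible_add[OF r(1) s] add(3)] by simp
qed

lemma single_reducible:
  assumes "vs \<in> X"
  shows "single vs \<in> reducible"
proof -
  \<comment> \<open>\<open>k\<close> bounds the positions that may still hold arbitrary vectors. At
    0 the tuple is a basis tuple; the induction step expands the entry at position
    \<open>k\<close>.\<close>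
  have "single vs \<in> reducible"
    if "k \<le> length Vs" "vs \<in> X" "\<And>i. k \<le> i \<Longrightarrow> i < length Vs \<Longrightarrow> vs ! i \<in> single ` (Bs ! i)" for k vs
    using that
  proof (induction k arbitrary: vs)
    case 0
    then have "\<forall>i<length Vs. \<exists>b\<in>Bs ! i. vs ! i = single b" by blast
    then obtain b where b: "\<And>i. i < length Vs \<Longrightarrow> b i \<in> Bs ! i \<and> vs ! i = single (b i)" by metis
    have "map b [0..<length Vs] \<in> listset Bs" using b by (simp add: listset_iff length_Bs)
    then obtain K where K: "K \<in> I" "\<beta> K = map b [0..<length Vs]"
      using bij_betw_imp_surj_on[OF bij] by (metis imageE)
    have "vs = basis_tuple K" unfolding basis_tuple_def K
      using b 0 by (auto intro!: nth_equalityI simp: X_iff)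
    then have "single vs = \<sigma> (single K)"
      using K(1) by (auto simp: fun_eq_iff \<sigma>_def single_def the_inv_into_f_f[OF inj_basis_tuple])
    then have "(\<lambda>t. single vs t - \<sigma> (single K) t) \<in> R" using R_closed(2) by simp
    then show ?case unfolding reducible_def using free_space_single[OF K(1)] by blast
  next
    case (Suc k)
    have k: "k < length Vs" "length vs = length Vs" using Suc.prems by (auto simp: X_iff)
    have basis: "single (vs[k := single b]) \<in> reducible" if b: "b \<in> Bs ! k" for b
    proof (rule Suc.IH)
      show "vs[k := single b] \<in> X" by (rule X_update[OF Suc.prems(2) k(1) free_space_single[OF b]])
      show "vs[k := single b] ! i \<in> single ` (Bs ! i)" if "k \<le> i" "i < length Vs" for i
        using Suc.prems(3)[of i] that k b by (cases "i = k") auto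
    qed (use k in simp)
    have "single (vs[k := vs ! k]) \<in> reducible"
      by (rule reducible_update[OF Suc.prems(2) k(1) _ basis]) (use Suc.prems(2) k(1) in \<open>auto simp: X_iff\<close>)
    then show ?case by simp
  qed
  from this[of "length Vs"] show ?thesis using assms by simp
qed

lemma kernel_R:
  assumes f: "f \<in> carrier F" "\<Phi> f = (\<lambda>K. 0)"
  shows "f \<in> R"
proof -
  have "f \<in> reducible" using f(1)
  proof (induction rule: free_space_induct)
    case zero
    show ?case using reducible_R R_closed(2) by blast
  next
    case (add b c g)
    then show ?case using reducible_add reducible_scale single_reducible by blast
  qed
  then obtain w where w: "w \<in> carrier (free_space I)" "(\<lambda>t. f t - \<sigma> w t) \<in> R"
    unfolding reducible_def by blast
  have k: "(\<lambda>t. f t - \<sigma> w t) \<in> carrier F" "\<Phi> (\<lambda>t. f t - \<sigma> w t) = (\<lambda>K. 0)"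
    using R_kernel w(2) by blast+
  have "\<Phi> f = \<Phi> (\<lambda>t. (f t - \<sigma> w t) + \<sigma> w t)" by simp
  also have "\<dots> = w" unfolding \<Phi>_add[OF k(1) \<sigma>_closed[OF w(1)]] k(2) \<Phi>_\<sigma>[OF w(1)] by simp
  finally have "w = (\<lambda>K. 0)" using f by simp
  then have "\<sigma> w = (\<lambda>t. 0)" by (auto simp: \<sigma>_def)
  then show "f \<in> R" using w(2) by simp
qed

lemma isomorphic_tensor_product: "isomorphic_spaces (free_space I) (tensor_product Vs)"
  unfolding tensor_product_def Let_def
proof (rule isomorphic_spaces_quotient[of X \<Phi> I])
  show "R = {f \<in> carrier F. \<Phi> f = (\<lambda>y. 0)}" using R_kernel kernel_R by blast
qed (use \<Phi>_closed \<Phi>_\<sigma> \<sigma>_closed \<Phi>_add \<Phi>_scale in blast)+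

end

section \<open>Factorizing sequences\<close>

context abelian_category
begin

text \<open>\<open>Ext1_zero\<close> is literally the set of split extensions. When it is the only
  class, every extension lies in it, because by reflexivity an extension belongs to its own
  class.\<close>

lemma splitting_pair_Ext1:
  assumes "Ext1 C M N = {Ext1_zero C M N}"
  shows "splitting_pair C M N"
  unfolding splitting_pair_def
proof (intro allI ballI impI)
  fix E i p assume i: "i \<in> Hom C N E" and p: "p \<in> Hom C E M" and ip: "short_exact C i p"
  have "(i, p) \<in> extensions C M N" unfolding extensions_def using ip HomD(2)[OF i] HomD(3)[OF p] by simp
  moreover have "ident C E \<in> Hom C (tgt C i) (tgt C i)" "is_iso C (ident C E)"
    using ident_closed ident_iso HomD(3,5)[OF i] by auto
  moreover have "ident C E \<cdot> i = i" "p \<cdot> ident C E = p" using ident_left ident_right i p by blast+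
  ultimately have 1: "((i, p), (i, p)) \<in> ext_equiv C M N" unfolding ext_equiv_def by blast
  have "ext_equiv C M N `` {(i, p)} \<in> Ext1 C M N"
    unfolding Ext1_def quotient_def using \<open>(i, p) \<in> extensions C M N\<close> by blast
  then have "ext_equiv C M N `` {(i, p)} = Ext1_zero C M N" using assms by simp
  with 1 have "(i, p) \<in> Ext1_zero C M N" by (metis ImageI singletonI)
  then show "\<exists>s\<in>Hom C M E. p \<cdot> s = ident C M" unfolding Ext1_zero_def using HomD(3)[OF i] by simp
qed

section \<open>Factorizing pairs in terms of isomorphism classes\<close>

lemma Iso_mono: "S \<subseteq> T \<Longrightarrow> Iso C S \<subseteq> Iso C T"
  unfolding Iso_def by blast

text \<open>The ends supplied by a subobject are merely isomorphic to objects of the two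
  subcategories; here they are exchanged for representatives lying inside them.\<close>

lemma factor_extends:
  assumes "U \<in> subobjects C X" "sub_objects C U = N" "N \<in> Iso C S''" "quot_objects C U = M" "M \<in> Iso C S'"
  obtains A Q where "A \<in> S''" "N = iso_class C A" "Q \<in> S'" "M = iso_class C Q" "extends C Q A X"
proof -
  obtain A Q where A: "N = iso_class C A" "M = iso_class C Q" "extends C Q A X"
    using subobject_extends[OF assms(1)] assms(2,4) by metis
  obtain A' Q' where "A' \<in> S''" "N = iso_class C A'" "Q' \<in> S'" "M = iso_class C Q'"
    using assms(3,5) unfolding Iso_def by blast
  moreover then have "extends C Q' A' X"
    using extends_iso_ends[OF A(3)] A iso_class_eq_iff extendsD[OF A(3)] by metis
  ultimately show ?thesis using that by blast
qed

lemma factorizing_pairD: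
  assumes "factorizing_pair C B S' S''"
  shows "S' \<subseteq> B" "S'' \<subseteq> B" "S' \<subseteq> Ob C" "S'' \<subseteq> Ob C"
  using assms unfolding factorizing_pair_def extension_closed_def by blast+

lemma factorizing_pair_ex1:
  assumes "factorizing_pair C B S' S''" "X \<in> B"
  shows "\<exists>!U. U \<in> subobjects C X \<and> sub_objects C U \<in> Iso C S'' \<and> quot_objects C U \<in> Iso C S'"
proof -
  note S = factorizing_pairD[OF assms(1)]
  have "sub_objects C U \<inter> S'' \<noteq> {} \<longleftrightarrow> sub_objects C U \<in> Iso C S''"
    "quot_objects C U \<inter> S' \<noteq> {} \<longleftrightarrow> quot_objects C U \<in> Iso C S'" if U: "U \<in> subobjects C X" for U
  proof -
    obtain A Q where "sub_objects C U = iso_class C A" "quot_objects C U = iso_class C Q" "extends C Q A X"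
      using subobject_extends[OF U] by metis
    then show "sub_objects C U \<inter> S'' \<noteq> {} \<longleftrightarrow> sub_objects C U \<in> Iso C S''"
      "quot_objects C U \<inter> S' \<noteq> {} \<longleftrightarrow> quot_objects C U \<in> Iso C S'"
      using iso_class_Iso_iff extendsD S by metis+
  qed
  then have "\<And>U. U \<in> subobjects C X \<and> sub_objects C U \<in> Iso C S'' \<and> quot_objects C U \<in> Iso C S' \<longleftrightarrow>
      U \<in> subobjects C X \<and> sub_objects C U \<inter> S'' \<noteq> {} \<and> quot_objects C U \<inter> S' \<noteq> {}" by blast
  then show ?thesis using assms unfolding factorizing_pair_def by simp
qed

lemma factorizing_pair_extends:
  assumes "factorizing_pair C B S' S''" "X \<in> B"
  obtains A Q where "A \<in> S''" "Q \<in> S'" "extends C Q A X"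
  using factorizing_pair_ex1[OF assms] factor_extends by metis

text \<open>Both extensions come from subobjects of \<open>X\<close> with classes in the two
  subcategories. These subobjects coincide, hence so do their classes.\<close>

lemma factorizing_pair_unique:
  assumes "factorizing_pair C B S' S''" "X \<in> B" "extends C Q A X" "extends C Q' A' X"
    "A \<in> S''" "A' \<in> S''" "Q \<in> S'" "Q' \<in> S'"
  shows "iso_class C A = iso_class C A'" "iso_class C Q = iso_class C Q'"
proof -
  have "iso_class C A \<in> Iso C S''" "iso_class C A' \<in> Iso C S''"
    "iso_class C Q \<in> Iso C S'" "iso_class C Q' \<in> Iso C S'"
    using assms(5-8) unfolding Iso_def by blast+
  then show "iso_class C A = iso_class C A'" "iso_class C Q = iso_class C Q'"
    using extends_subobject[OF assms(3)] extends_subobject[OF assms(4)]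
      factorizing_pair_ex1[OF assms(1,2)] by metis+
qed

section \<open>Products of exponentials\<close>

lemma some_iso_class:
  assumes "K \<in> Iso C (Ob C)"
  shows "(SOME X. X \<in> K) \<in> Ob C" "iso_class C (SOME X. X \<in> K) = K"
proof -
  obtain Y where Y: "Y \<in> Ob C" "K = iso_class C Y" using assms unfolding Iso_def by blast
  then have "Y \<in> K" using isomorphic_refl unfolding iso_class_def by blast
  then have "(SOME X. X \<in> K) \<in> K" by (rule someI)
  then have "(SOME X. X \<in> K) \<in> Ob C" "isomorphic C Y (SOME X. X \<in> K)"
    using Y(2) unfolding iso_class_def by blast+
  then show "(SOME X. X \<in> K) \<in> Ob C" "iso_class C (SOME X. X \<in> K) = K"
    using iso_class_eq_iff[OF Y(1)] Y(2) by blast+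
qed

lemma iso_class_in_Iso_iff:
  assumes "iso_closed B" "X \<in> Ob C"
  shows "iso_class C X \<in> Iso C B \<longleftrightarrow> X \<in> B"
  using assms iso_class_eq_iff isomorphic_sym unfolding iso_closed_def Iso_def by blast

text \<open>Finiteness of the set of terms and the value of their sum are both read off from this
  one description.\<close>

lemma hall_terms_Exp:
  assumes "factorizing_pair C B S' S''" "extension_closed C B" "iso_closed B" "K \<in> Iso C (Ob C)"
  shows "\<exists>M N. hall_terms C (Exp C S') (Exp C S'') K = (if K \<in> Iso C B then {(M, N)} else {}) \<and>
    (K \<in> Iso C B \<longrightarrow> Exp C S' M * Exp C S'' N * of_nat (hall_number C M N K) = 1)"
proof -
  note S = factorizing_pairD[OF assms(1)]
  define X where "X = (SOME X. X \<in> K)"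
  have X: "X \<in> Ob C" "iso_class C X = K" using some_iso_class[OF assms(4)] unfolding X_def by blast+
  have KB: "K \<in> Iso C B \<longleftrightarrow> X \<in> B" using iso_class_in_Iso_iff[OF assms(3) X(1)] X(2) by simp
  have num: "hall_number C M N K =
      card {U \<in> subobjects C X. sub_objects C U = N \<and> quot_objects C U = M}" for M N
    unfolding hall_number_def X_def ..
  have terms: "hall_terms C (Exp C S') (Exp C S'') K =
      {(M, N). M \<in> Iso C S' \<and> N \<in> Iso C S'' \<and> hall_number C M N K \<noteq> 0}"
    unfolding hall_terms_def Exp_def using Iso_mono[OF S(3)] Iso_mono[OF S(4)] by auto
  show ?thesis
  proof (cases "X \<in> B")
    case False
    have "{U \<in> subobjects C X. sub_objects C U = N \<and> quot_objects C U = M} = {}"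
      if MN: "M \<in> Iso C S'" "N \<in> Iso C S''" for M N
    proof (rule ccontr)
      assume "{U \<in> subobjects C X. sub_objects C U = N \<and> quot_objects C U = M} \<noteq> {}"
      then obtain U where U: "U \<in> subobjects C X" "sub_objects C U = N" "quot_objects C U = M" by blast
      obtain A Q where "A \<in> S''" "Q \<in> S'" "extends C Q A X"
        using factor_extends[OF U(1,2) MN(2) U(3) MN(1)] .
      then show False using extension_closedD[OF assms(2)] S False by blast
    qed
    then have "hall_terms C (Exp C S') (Exp C S'') K = {}" unfolding terms num by fastforce
    then show ?thesis using KB False by simp
  next
    case True
    obtain U where U: "U \<in> subobjects C X" "sub_objects C U \<in> Iso C S''" "quot_objects C U \<in> Iso C S'"
      and un: "\<And>V. V \<in> subobjects C X \<Longrightarrow> sub_objects C V \<in> Iso C S'' \<Longrightarrow> quot_objects C V \<in> Iso C S' \<Longrightarrow> V = U"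
      using factorizing_pair_ex1[OF assms(1) True] by blast
    have "{V \<in> subobjects C X. sub_objects C V = N \<and> quot_objects C V = M} =
        (if M = quot_objects C U \<and> N = sub_objects C U then {U} else {})"
      if "M \<in> Iso C S'" "N \<in> Iso C S''" for M N
      using that U(1) by (auto dest: un)
    then have n: "hall_number C M N K = (if M = quot_objects C U \<and> N = sub_objects C U then 1 else 0)"
      if "M \<in> Iso C S'" "N \<in> Iso C S''" for M N using that unfolding num by simp
    have "hall_terms C (Exp C S') (Exp C S'') K = {(quot_objects C U, sub_objects C U)}"
      unfolding terms using n U by (auto split: if_splits)
    moreover have "Exp C S' (quot_objects C U) * Exp C S'' (sub_objects C U) *
        of_nat (hall_number C (quot_objects C U) (sub_objects C U) K) = (1 :: rat)"
      using n U by (simp add: Exp_def)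
    ultimately show ?thesis using KB True by auto
  qed
qed

lemma hall_mult_Exp:
  assumes "factorizing_pair C B S' S''" "extension_closed C B" "iso_closed B"
  shows "hall_mult_defined C (Exp C S') (Exp C S'')"
    and "hall_mult C (Exp C S') (Exp C S'') = Exp C B"
proof -
  show "hall_mult_defined C (Exp C S') (Exp C S'')"
    unfolding hall_mult_defined_def using hall_terms_Exp[OF assms] by (metis finite.simps)
  have BO: "Iso C B \<subseteq> Iso C (Ob C)" using Iso_mono assms(2) unfolding extension_closed_def by blast
  show "hall_mult C (Exp C S') (Exp C S'') = Exp C B"
  proof
    fix K
    show "hall_mult C (Exp C S') (Exp C S'') K = Exp C B K"
    proof (cases "K \<in> Iso C (Ob C)")
      case True
      obtain M N where t: "hall_terms C (Exp C S') (Exp C S'') K = (if K \<in> Iso C B then {(M, N)} else {})"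
        "K \<in> Iso C B \<longrightarrow> Exp C S' M * Exp C S'' N * of_nat (hall_number C M N K) = 1"
        using hall_terms_Exp[OF assms True] by blast
      then show ?thesis unfolding hall_mult_def using True by (simp add: Exp_def[of C B])
    next
      case False
      then show ?thesis using BO unfolding hall_mult_def Exp_def by auto
    qed
  qed
qed

text \<open>Products are bracketed to the left, so the last factor comes off first, as in the
  recursion for factorizing sequences.\<close>

lemma hall_prod_append: "hall_prod C f (gs @ [g]) = hall_mult C (hall_prod C f gs) g"
  by (induction gs arbitrary: f) auto

lemma hall_prod_defined_append:
  "hall_prod_defined C f (gs @ [g]) \<longleftrightarrow> hall_prod_defined C f gs \<and> hall_mult_defined C (hall_prod C f gs) g"
  by (induction gs arbitrary: f) auto

text \<open>\<open>B\<close> varies in the induction: the initial segment factorizes the subcategory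
  that it generates within \<open>B\<close>, which inherits both closure properties.\<close>

lemma hall_prod_Exp:
  assumes "factorizing_sequence C B Ss" "extension_closed C B" "iso_closed B"
  shows "hall_prod_defined C (hd (map (Exp C) Ss)) (tl (map (Exp C) Ss)) \<and>
    hall_prod C (hd (map (Exp C) Ss)) (tl (map (Exp C) Ss)) = Exp C B"
  using assms
proof (induction rule: factorizing_sequence.induct)
  case (pair B S' S'')
  then show ?case using hall_mult_Exp by simp
next
  case (snoc Ss B S)
  note G = generated_subcategory_closed[OF snoc.prems, of Ss]
  have "Ss \<noteq> []" using snoc.hyps(1) by auto
  then show ?case
    using snoc.IH[OF G] hall_mult_Exp[OF snoc.hyps(3) snoc.prems]
    by (simp add: hall_prod_append hall_prod_defined_append)
qed

text \<open>An object of \<open>B\<close> is an extension of its factorization pieces, and the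
  quotient piece factorizes again. Thus iterated extensions reach every object, although the
  generated subcategory is defined as an intersection.\<close>

lemma factorizing_sequence_splitting:
  assumes "factorizing_sequence C B Ss" "\<And>S M. S \<in> set Ss \<Longrightarrow> M \<in> S \<Longrightarrow> splitting_pair C M N" "X \<in> B"
  shows "splitting_pair C X N"
  using assms
proof (induction arbitrary: X rule: factorizing_sequence.induct)
  case (pair B S' S'')
  obtain A Q where "A \<in> S''" "Q \<in> S'" "extends C Q A X"
    using factorizing_pair_extends[OF pair.hyps pair.prems(2)] .
  then show ?case
    using splitting_pair_extension[of A N Q X] pair.prems(1)[of S''] pair.prems(1)[of S'] by simp
next
  case (snoc Ss B S)
  obtain A Q where A: "A \<in> S" "Q \<in> generated_subcategory C B Ss" "extends C Q A X"
    using factorizing_pair_extends[OF snoc.hyps(3) snoc.prems(2)] .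
  have "splitting_pair C Q N" by (rule snoc.IH[OF _ A(2)]) (use snoc.prems(1) in auto)
  with A show ?case using splitting_pair_extension[of A N Q X] snoc.prems(1)[of S] by simp
qed

text \<open>The map built here goes from pairs of classes to classes of direct sums. Injectivity is
  uniqueness of the factorization; splitting gives surjectivity.\<close>

lemma factorizing_pair_bij:
  assumes "factorizing_pair C B S' S''" "extension_closed C B" "iso_closed B"
    and split: "\<And>M N. M \<in> S' \<Longrightarrow> N \<in> S'' \<Longrightarrow> splitting_pair C M N"
  shows "\<exists>f. bij_betw f (Iso C S' \<times> Iso C S'') (Iso C B)"
proof -
  note S = factorizing_pairD[OF assms(1)]
  \<comment> \<open>Representatives are taken inside \<open>T\<close> itself, so that the hypotheses
    on \<open>S'\<close> and \<open>S''\<close> apply to them.\<close>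
  define r where "r T M = (SOME X. X \<in> T \<and> iso_class C X = M)" for T M
  have r: "r T M \<in> T" "iso_class C (r T M) = M" if "M \<in> Iso C T" for T M
    using that someI_ex[of "\<lambda>X. X \<in> T \<and> iso_class C X = M"] unfolding Iso_def r_def by blast+
  define P where "P M N = (SOME X. is_biproduct C (r S'' N) (r S' M) X)" for M N
  have P: "is_biproduct C (r S'' N) (r S' M) (P M N)" if "M \<in> Iso C S'" "N \<in> Iso C S''" for M N
    unfolding P_def by (rule someI_ex, rule biproducts) (use r(1) that S in blast)+
  have ext: "extends C (r S' M) (r S'' N) (P M N)" if "M \<in> Iso C S'" "N \<in> Iso C S''" for M N
    using biproduct_extends P that by blast
  have PB: "P M N \<in> B" if "M \<in> Iso C S'" "N \<in> Iso C S''" for M N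
    using extension_closedD[OF assms(2) ext] r(1) that S by blast
  have "bij_betw (\<lambda>(M, N). iso_class C (P M N)) (Iso C S' \<times> Iso C S'') (Iso C B)"
    unfolding bij_betw_def
  proof
    show "inj_on (\<lambda>(M, N). iso_class C (P M N)) (Iso C S' \<times> Iso C S'')"
    proof (rule inj_onI, clarify)
      fix M N M' N' assume m: "M \<in> Iso C S'" "N \<in> Iso C S''" "M' \<in> Iso C S'" "N' \<in> Iso C S''"
        and eq: "iso_class C (P M N) = iso_class C (P M' N')"
      have "isomorphic C (P M' N') (P M N)"
        using eq iso_class_eq_iff extendsD[OF ext[OF m(3,4)]] by metis
      then have "extends C (r S' M') (r S'' N') (P M N)" using extends_iso_middle ext m by blast
      then show "M = M' \<and> N = N'"
        using factorizing_pair_unique[OF assms(1) PB[OF m(1,2)] ext[OF m(1,2)], of "r S' M'" "r S'' N'"]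
          r m by metis
    qed
    show "(\<lambda>(M, N). iso_class C (P M N)) ` (Iso C S' \<times> Iso C S'') = Iso C B"
    proof (intro equalityI subsetI)
      fix K assume "K \<in> (\<lambda>(M, N). iso_class C (P M N)) ` (Iso C S' \<times> Iso C S'')"
      then show "K \<in> Iso C B" using PB unfolding Iso_def[of C B] by auto
    next
      fix K assume "K \<in> Iso C B"
      then obtain X where X: "X \<in> B" "K = iso_class C X" unfolding Iso_def by blast
      obtain A Q where A: "A \<in> S''" "Q \<in> S'" "extends C Q A X"
        using factorizing_pair_extends[OF assms(1) X(1)] .
      define M N where "M = iso_class C Q" and "N = iso_class C A"
      have MN: "M \<in> Iso C S'" "N \<in> Iso C S''" unfolding M_def N_def Iso_def using A by blast+
      have "isomorphic C Q (r S' M)" "isomorphic C A (r S'' N)"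
        using r(2)[OF MN(1)] r(2)[OF MN(2)] iso_class_eq_iff A S unfolding M_def N_def by blast+
      then have "extends C (r S' M) (r S'' N) X" using extends_iso_ends A by blast
      then have "is_biproduct C (r S'' N) (r S' M) X"
        using extends_splitting_pair_biproduct split r(1) MN by blast
      then have "isomorphic C X (P M N)" using biproduct_unique_iso P MN by blast
      then have "K = iso_class C (P M N)" using iso_class_eq_iff X extendsD[OF A(3)] by blast
      then show "K \<in> (\<lambda>(M, N). iso_class C (P M N)) ` (Iso C S' \<times> Iso C S'')" using MN by auto
    qed
  qed
  then show ?thesis by blast
qed

end

lemma bij_betw_listset_snoc: "bij_betw (\<lambda>(xs, x). xs @ [x]) (listset As \<times> A) (listset (As @ [A]))"
  unfolding bij_betw_def
proof
  show "inj_on (\<lambda>(xs, x). xs @ [x]) (listset As \<times> A)" by (auto simp: inj_on_def)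
  show "(\<lambda>(xs, x). xs @ [x]) ` (listset As \<times> A) = listset (As @ [A])"
  proof (intro equalityI subsetI)
    fix ys assume "ys \<in> (\<lambda>(xs, x). xs @ [x]) ` (listset As \<times> A)"
    then show "ys \<in> listset (As @ [A])" by (auto simp: listset_iff nth_append less_Suc_eq)
  next
    fix ys assume ys: "ys \<in> listset (As @ [A])"
    then have "ys \<noteq> []" by (auto simp: listset_iff)
    then obtain xs x where "ys = xs @ [x]" by (metis append_butlast_last_id)
    moreover then have "xs \<in> listset As" "x \<in> A"
      using ys by (auto simp: listset_iff nth_append split: if_splits)
    ultimately show "ys \<in> (\<lambda>(xs, x). xs @ [x]) ` (listset As \<times> A)" by force
  qed
qed

context abelian_category
begin

lemma factorizing_sequence_bij:
  assumes "factorizing_sequence C B Ss" "extension_closed C B" "iso_closed B"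
    and "\<And>i j M N. \<lbrakk>i < j; j < length Ss; M \<in> Ss ! i; N \<in> Ss ! j\<rbrakk> \<Longrightarrow> splitting_pair C M N"
  shows "\<exists>f. bij_betw f (listset (map (Iso C) Ss)) (Iso C B)"
  using assms
proof (induction rule: factorizing_sequence.induct)
  case (pair B S' S'')
  have "splitting_pair C M N" if "M \<in> S'" "N \<in> S''" for M N using pair.prems(3)[of 0 1 M N] that by simp
  then obtain f where f: "bij_betw f (Iso C S' \<times> Iso C S'') (Iso C B)"
    using factorizing_pair_bij[OF pair.hyps pair.prems(1,2)] by blast
  have "bij_betw (\<lambda>xs. (xs ! 0, xs ! 1)) (listset (map (Iso C) [S', S''])) (Iso C S' \<times> Iso C S'')"
    by (rule bij_betw_byWitness[where f' = "\<lambda>(a, b). [a, b]"]) (auto simp: set_Cons_def)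
  then show ?case using bij_betw_trans f by blast
next
  case (snoc Ss B S)
  let ?G = "generated_subcategory C B Ss"
  have "splitting_pair C M N" if "i < j" "j < length Ss" "M \<in> Ss ! i" "N \<in> Ss ! j" for i j M N
    using snoc.prems(3)[of i j M N] that by (simp add: nth_append)
  then obtain f where f: "bij_betw f (listset (map (Iso C) Ss)) (Iso C ?G)"
    using snoc.IH[OF generated_subcategory_closed[OF snoc.prems(1,2)]] by blast
  \<comment> \<open>The case \<open>j = length Ss\<close> of the hypothesis concerns the last
    member; it then extends from the earlier members to everything that they generate.\<close>
  have "splitting_pair C M N" if "T \<in> set Ss" "M \<in> T" "N \<in> S" for T M N
    using that snoc.prems(3)[of _ "length Ss" M N] by (auto simp: in_set_conv_nth nth_append)
  then have "splitting_pair C M N" if "M \<in> ?G" "N \<in> S" for M N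
    using factorizing_sequence_splitting[OF snoc.hyps(2)] that by blast
  then obtain g where g: "bij_betw g (Iso C ?G \<times> Iso C S) (Iso C B)"
    using factorizing_pair_bij[OF snoc.hyps(3) snoc.prems(1,2)] by blast
  have "bij_betw (map_prod f id) (listset (map (Iso C) Ss) \<times> Iso C S) (Iso C ?G \<times> Iso C S)"
    using bij_betw_map_prod[OF f bij_betw_id] .
  then have "bij_betw (g \<circ> map_prod f id) (listset (map (Iso C) Ss) \<times> Iso C S) (Iso C B)"
    using g bij_betw_trans by blast
  then show ?case
    using bij_betw_trans[OF bij_betw_inv_into[OF bij_betw_listset_snoc[of "map (Iso C) Ss" "Iso C S"]]]
    by simp blast
qed

end

theorem proposition1p10:
  fixes C :: "('o, 'm) preadd_cat" and As :: "'o set list"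
  assumes "finitary_abelian_category C"
    and "factorizing_sequence C (Ob C) As"
  shows "(let Es = map (Exp C) As in
            hall_prod_defined C (hd Es) (tl Es) \<and>
            Exp C (Ob C) = hall_prod C (hd Es) (tl Es)) \<and>
         ((\<forall>i j. i < j \<and> j < length As \<longrightarrow>
             (\<forall>M\<in>As ! i. \<forall>N\<in>As ! j. Ext1 C M N = {Ext1_zero C M N})) \<longrightarrow>
          isomorphic_spaces (hall_algebra C (Ob C))
            (tensor_product (map (hall_algebra C) As)))"
proof -
  interpret finitary_abelian_category C by (rule assms(1))
  have Exp: "hall_prod_defined C (hd (map (Exp C) As)) (tl (map (Exp C) As))"
    "Exp C (Ob C) = hall_prod C (hd (map (Exp C) As)) (tl (map (Exp C) As))"
    using hall_prod_Exp[OF assms(2) extension_closed_Ob iso_closed_Ob] by simp_all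
  have "isomorphic_spaces (hall_algebra C (Ob C)) (tensor_product (map (hall_algebra C) As))"
    if Ext: "\<forall>i j. i < j \<and> j < length As \<longrightarrow> (\<forall>M\<in>As ! i. \<forall>N\<in>As ! j. Ext1 C M N = {Ext1_zero C M N})"
  proof -
    have "splitting_pair C M N" if "i < j" "j < length As" "M \<in> As ! i" "N \<in> As ! j" for i j M N
      using splitting_pair_Ext1 Ext that by blast
    then obtain f where "bij_betw f (listset (map (Iso C) As)) (Iso C (Ob C))"
      using factorizing_sequence_bij[OF assms(2) extension_closed_Ob iso_closed_Ob] by blast
    \<comment> \<open>\<open>\<beta>\<close> has to lead from classes to lists of classes, so it is
      the inverse of \<open>f\<close>.\<close>
    then interpret tensor_of_free_spaces "map (hall_algebra C) As" "map (Iso C) As" "Iso C (Ob C)"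
        "inv_into (listset (map (Iso C) As)) f"
      by unfold_locales (simp_all add: hall_algebra_def free_space_def bij_betw_inv_into)
    \<comment> \<open>\<open>isomorphic_spaces\<close> sees only carrier, addition and scaling, on
      which \<open>hall_algebra\<close> and \<open>free_space\<close> agree.\<close>
    show ?thesis
      using isomorphic_tensor_product by (simp add: isomorphic_spaces_def hall_algebra_def)
  qed
  then show ?thesis using Exp by (simp add: Let_def)
qed

end
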